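(* Let $d>k\ge 1$ be integers, $p>1$, and let $a,b,\gamma\in\mathbb{R}$ satisfy $$k+a>0,\qquad d+a-p>b,\qquad k+a-p>b-\gamma,$$ and assume $\gamma\ge b$. Then $S_{b,\gamma}$ is not achieved on $\mathcal{D}^{1,p}(\mathbb{R}^d;|y|^a|z|^{-b}dz)$; that is, there is no $u\in\mathcal{D}^{1,p}(\mathbb{R}^d;|y|^a|z|^{-b}dz)\setminus\{0\}$ such that $$\int_{\mathbb{R}^d}|y|^{a}|z|^{-b}|\nabla u|^p\,dz=S_{b,\gamma}\int_{\mathbb{R}^d}|y|^{a-p-b+\gamma}|z|^{-\gamma}|u|^p\,dz .$$
   Context: Write $\mathbb{R}^d\equiv\mathbb{R}^k\times\mathbb{R}^{d-k}\ni (y,x)\equiv z$. $\mathcal{D}^{1,p}(\mathbb{R}^d;|y|^a|z|^{-b}dz)$ is the completion of $C_c^\infty(\mathbb{R}^d)$ with respect to the norm $\|u\|=\big(\int_{\mathbb{R}^d}|y|^a|z|^{-b}|\nabla u|^p\,dz\big)^{1/p}$. (If $k+a>0$ and $d+a-p>b$, the known Hardy inequality $\big(\frac{d+a-p-b}{p}\big)^p\int|y|^a|z|^{-b-p}|u|^p\,dz\le\int|y|^a|z|^{-b}|\nabla u|^p\,dz$ identifies it with a space of functions.) $S_{b,\gamma}$ is the best constant in $S_{b,\gamma}\int_{\mathbb{R}^d}|y|^{a-p-b+\gamma}|z|^{-\gamma}|u|^p\,dz\le\int_{\mathbb{R}^d}|y|^{a}|z|^{-b}|\nabla u|^p\,dz$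 for $u\in C_c^\infty(\mathbb{R}^d)$, equivalently the infimum over nonzero $u\in\mathcal{D}^{1,p}(\mathbb{R}^d;|y|^a|z|^{-b}dz)$ of the quotient of the right-hand integral by the left-hand integral. *)

theory Defs
  imports "HOL-Analysis.Analysis"
begin

text \<open>
  Points of $\mathbb{R}^d = \mathbb{R}^k \times \mathbb{R}^{d-k}$ are pairs \<open>z = (y, x)\<close> in a product
  of two Euclidean spaces, so that \<open>k = DIM('k)\<close> and \<open>d = DIM('k \<times> 'm)\<close>. Dimensions of Euclidean
  spaces are positive, hence \<open>d > k \<ge> 1\<close> holds by typing. The product norm is the Euclidean one.
\<close>

primrec higher_differentiable :: "nat \<Rightarrow> ('a::euclidean_space \<Rightarrow> real) \<Rightarrow> bool" where
  "higher_differentiable 0 f \<longleftrightarrow> continuous_on UNIV f"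
| "higher_differentiable (Suc n) f \<longleftrightarrow>
     (\<forall>x. f differentiable (at x)) \<and>
     (\<forall>v. higher_differentiable n (\<lambda>x. frechet_derivative f (at x) v))"

definition Cc_infinity :: "('a::euclidean_space \<Rightarrow> real) set" where
  "Cc_infinity = {\<phi>. (\<forall>n. higher_differentiable n \<phi>) \<and> compact (closure {z. \<phi> z \<noteq> 0})}"

definition gradient :: "('a::euclidean_space \<Rightarrow> real) \<Rightarrow> 'a \<Rightarrow> 'a" where
  "gradient f z = (\<Sum>i\<in>Basis. frechet_derivative f (at z) i *\<^sub>R i)"

lemma GDERIV_gradient:
  assumes "f differentiable (at z)"
  shows "GDERIV f z :> gradient f z"
proof -
  interpret linear "frechet_derivative f (at z)"
    by (rule linear_frechet_derivative[OF assms])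
  have "frechet_derivative f (at z) = (\<lambda>h. h \<bullet> gradient f z)"
  proof
    fix h
    have "frechet_derivative f (at z) h
        = frechet_derivative f (at z) (\<Sum>i\<in>Basis. (h \<bullet> i) *\<^sub>R i)"
      by (simp add: euclidean_representation)
    also have "\<dots> = h \<bullet> gradient f z"
      by (simp add: gradient_def sum scale inner_sum_right mult.commute)
    finally show "frechet_derivative f (at z) h = h \<bullet> gradient f z" .
  qed
  then show ?thesis
    using assms by (simp add: gderiv_def frechet_derivative_works)
qed

text \<open>
  $\int |y|^\alpha |z|^\beta |f|^p\,dz$ with values in \<open>[0, \<infinity>]\<close>, for scalar or vector-valued \<open>f\<close>.
  Since \<open>0 powr r = 0\<close>, the weight is \<open>0\<close> on \<open>{y = 0}\<close>, which is a null set because \<open>k \<ge> 1\<close>.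
\<close>

definition weighted_integral ::
    "real \<Rightarrow> real \<Rightarrow> real \<Rightarrow> ('k::euclidean_space \<times> 'm::euclidean_space \<Rightarrow> 'v::real_normed_vector) \<Rightarrow> ennreal"
  where
  "weighted_integral \<alpha> \<beta> p f =
     (\<integral>\<^sup>+z. ennreal (norm (fst z) powr \<alpha> * norm z powr \<beta> * norm (f z) powr p) \<partial>lborel)"

text \<open>
  The completion $\mathcal{D}^{1,p}(\mathbb{R}^d; |y|^a |z|^{-b} dz)$ in its realisation as a space of
  functions. A sequence of test functions that is Cauchy for the norm
  $(\int |y|^a |z|^{-b} |\nabla \phi|^p)^{1/p}$ has gradients converging to some \<open>G\<close> in
  $L^p(|y|^a |z|^{-b} dz)$, and by the Hardy inequality it converges itself to some \<open>u\<close> in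
  $L^p(|y|^a |z|^{-b-p} dz)$. An element of the completion is thus represented by a function \<open>u\<close>
  together with its gradient \<open>G = \<nabla>u\<close>: the space is the closure of the graph
  \<open>{(\<phi>, gradient \<phi>)}\<close>. When \<open>k + a > 0\<close> and \<open>d + a - p > b\<close>, each of \<open>u\<close> and \<open>G\<close> determines the other
  almost everywhere. Locally integrable weak derivatives on the whole space are not available in
  general: for large \<open>a\<close> the functions in these weighted spaces need not be locally integrable.
  Pairs equal almost everywhere represent the same element.
\<close>

definition D1p ::
    "real \<Rightarrow> real \<Rightarrow> real \<Rightarrow>
      (('k::euclidean_space \<times> 'm::euclidean_space \<Rightarrow> real) \<times> ('k \<times> 'm \<Rightarrow> 'k \<times> 'm)) set"
  where
  "D1p p a b = {(u, G). u \<in> borel_measurable lborel \<and> G \<in> borel_measurable lborel \<and>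
     (\<exists>\<phi>. (\<forall>n. \<phi> n \<in> Cc_infinity) \<and>
          (\<lambda>n. weighted_integral a (- b) p (\<lambda>z. gradient (\<phi> n) z - G z)) \<longlonglongrightarrow> 0 \<and>
          (\<lambda>n. weighted_integral a (- b - p) p (\<lambda>z. \<phi> n z - u z)) \<longlonglongrightarrow> 0)}"

definition best_constant ::
    "('k::euclidean_space \<times> 'm::euclidean_space) itself \<Rightarrow>
      real \<Rightarrow> real \<Rightarrow> real \<Rightarrow> real \<Rightarrow> ennreal"
  where
  "best_constant _ p a b \<gamma> =
     Sup {S. \<forall>\<phi> \<in> (Cc_infinity :: ('k \<times> 'm \<Rightarrow> real) set).
       S * weighted_integral (a - p - b + \<gamma>) (- \<gamma>) p \<phi> \<le> weighted_integral a (- b) p (gradient \<phi>)}"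

end

theory Submission
  imports Defs
begin

text \<open>
  Both integrals in the inequality are invariant under the dilations
  \<open>T\<^sub>s u (z) = e\<^sup>H\<^sup>s u (e\<^sup>s z)\<close> with \<open>H p = d + a - b - p\<close>, and the energy has a hidden convexity: for
  functions \<open>f\<close>, \<open>g\<close> the power mean \<open>U = ((|f|\<^sup>p + |g|\<^sup>p) / 2)\<^sup>1\<^sup>/\<^sup>p\<close> satisfies
  \<open>|\<nabla>U|\<^sup>p \<le> (|\<nabla>f|\<^sup>p + |\<nabla>g|\<^sup>p) / 2\<close> pointwise, because \<open>\<nabla>U / U\<close> is a convex combination of
  \<open>\<nabla>f / f\<close> and \<open>\<nabla>g / g\<close>. Equality forces \<open>g \<nabla>f = f \<nabla>g\<close>.

  Suppose that \<open>u\<close> attains the best constant. The power mean of \<open>u\<close> and \<open>T\<^sub>s u\<close> has the same right-hand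
  mass as \<open>u\<close>, so its energy cannot be smaller than that of \<open>u\<close>, and equality holds in the convexity
  inequality almost everywhere. Hence \<open>T\<^sub>s u \<cdot> \<nabla>u = u \<cdot> \<nabla>(T\<^sub>s u)\<close> for every \<open>s\<close>
  (\<open>minimiser_gradient_proportional_dilate\<close>). Since \<open>u\<close> is only a limit of test functions \<open>\<phi>\<^sub>n\<close>, the
  argument is run with smooth regularised means of \<open>\<phi>\<^sub>n\<close> and \<open>T\<^sub>s \<phi>\<^sub>n\<close>, and the deficit in the convexity
  inequality is passed to the limit by Fatou's lemma.

  The radial part of this identity says that, along the orbit \<open>t \<mapsto> e\<^sup>t z\<close>, the function
  \<open>t \<mapsto> T\<^sub>t u (z)\<close> satisfies a linear differential equation \<open>q' = c q\<close> whose coefficient depends on the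
  orbit only. Therefore \<open>T\<^sub>s u (z) = e\<^sup>s\<^sup>c\<^sup>(\<^sup>z\<^sup>) u (z)\<close> wherever \<open>u\<close> does not vanish
  (\<open>dilate_eq_exp_if_gradient_proportional\<close>). The dilations are isometries of the space
  \<open>L\<^sup>p(|y|\<^sup>a |z|\<^sup>-\<^sup>b\<^sup>-\<^sup>p dz)\<close>, which contains \<open>u\<close>; comparing \<open>T\<^sub>1 u\<close> and \<open>T\<^sub>-\<^sub>1 u\<close> with \<open>u\<close> by
  \<open>e\<^sup>x + e\<^sup>-\<^sup>x \<ge> 2\<close> gives \<open>c = 0\<close>, that is, \<open>u\<close> is homogeneous. Then all balls around the origin carry the
  same amount of the finite norm of \<open>u\<close>, and this amount tends to \<open>0\<close> with the radius, so \<open>u = 0\<close>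
  (\<open>dilate_eq_exp_imp_zero\<close>).
\<close>

section \<open>Smooth functions and their dilations\<close>

lemma higher_differentiable_const: "higher_differentiable n (\<lambda>x. c)"
  by (induction n arbitrary: c) (auto simp: frechet_derivative_const)

lemma higher_differentiable_Suc_imp:
  "higher_differentiable (Suc n) f \<Longrightarrow> higher_differentiable n f"
proof (induction n arbitrary: f)
  case 0
  then show ?case
    by (auto simp: continuous_on_eq_continuous_at intro: differentiable_imp_continuous_within)
next
  case (Suc n)
  then show ?case by auto
qed

lemma higher_differentiable_add:
  "higher_differentiable n f \<Longrightarrow> higher_differentiable n g \<Longrightarrow>
    higher_differentiable n (\<lambda>x. f x + g x)"
proof (induction n arbitrary: f g)
  case 0
  then show ?case by (auto intro: continuous_intros)
next
  case (Suc n)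
  have "frechet_derivative (\<lambda>x. f x + g x) (at x) =
      (\<lambda>v. frechet_derivative f (at x) v + frechet_derivative g (at x) v)" for x
    using Suc.prems by (intro frechet_derivative_at[symmetric]) 
     (auto intro!: derivative_eq_intros simp: frechet_derivative_works)
  then show ?case using Suc by (auto intro: differentiable_add)
qed

lemma higher_differentiable_mult:
  "higher_differentiable n f \<Longrightarrow> higher_differentiable n g \<Longrightarrow>
    higher_differentiable n (\<lambda>x. f x * g x)"
proof (induction n arbitrary: f g)
  case 0
  then show ?case by (auto intro: continuous_intros)
next
  case (Suc n)
  have fr: "frechet_derivative (\<lambda>x. f x * g x) (at x) =
      (\<lambda>v. f x * frechet_derivative g (at x) v + frechet_derivative f (at x) v * g x)" for x
    using Suc.prems by (intro frechet_derivative_at[symmetric]) 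
     (auto intro!: derivative_eq_intros simp: frechet_derivative_works)
  have "higher_differentiable n f" "higher_differentiable n g"
    using Suc.prems higher_differentiable_Suc_imp by blast+
  then show ?case using Suc by (auto simp: fr intro!: higher_differentiable_add)
qed

lemma has_derivative_powr_const:
  fixes f :: "'a::real_normed_vector \<Rightarrow> real"
  assumes "(f has_derivative f') (at x)" "f x > 0"
  shows "((\<lambda>x. f x powr r) has_derivative (\<lambda>v. r * f x powr (r - 1) * f' v)) (at x)"
  using assms by (auto intro!: derivative_eq_intros simp: powr_diff)

lemma frechet_derivative_powr_pos:
  assumes "f differentiable (at x)" "f x > (0::real)"
  shows "frechet_derivative (\<lambda>x. f x powr r) (at x) =
      (\<lambda>v. r * f x powr (r - 1) * frechet_derivative f (at x) v)"
    and "(\<lambda>x. f x powr r) differentiable (at x)"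
proof -
  have "((\<lambda>x. f x powr r) has_derivative
      (\<lambda>v. r * f x powr (r - 1) * frechet_derivative f (at x) v)) (at x)"
    using assms by (intro has_derivative_powr_const) (auto simp: frechet_derivative_works)
  then show "frechet_derivative (\<lambda>x. f x powr r) (at x) =
      (\<lambda>v. r * f x powr (r - 1) * frechet_derivative f (at x) v)"
    and "(\<lambda>x. f x powr r) differentiable (at x)"
    by (auto intro: frechet_derivative_at[symmetric] simp: differentiable_def)
qed

text \<open>
  The derivative of a power contains a different exponent, so the induction has to treat all exponents
  at once.
\<close>

lemma higher_differentiable_powr:
  "higher_differentiable n f \<Longrightarrow> (\<And>x. f x > 0) \<Longrightarrow> higher_differentiable n (\<lambda>x. f x powr r)"
proof (induction n arbitrary: r)
  case 0
  have "f x \<noteq> 0" for x using 0(2)[of x] by auto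
  with 0 show ?case by (auto intro!: continuous_intros)
next
  case (Suc n)
  have "higher_differentiable n f"
    using Suc.prems higher_differentiable_Suc_imp by blast
  then show ?case using Suc
    by (auto simp: frechet_derivative_powr_pos
        intro!: higher_differentiable_mult higher_differentiable_const)
qed

lemma frechet_derivative_scaleR_arg:
  fixes f :: "'a::euclidean_space \<Rightarrow> real"
  assumes "\<And>x. f differentiable (at x)"
  shows "frechet_derivative (\<lambda>x. f (t *\<^sub>R x)) (at x) =
      (\<lambda>v. t * frechet_derivative f (at (t *\<^sub>R x)) v)"
    and "(\<lambda>x. f (t *\<^sub>R x)) differentiable (at x)"
proof -
  interpret linear "frechet_derivative f (at (t *\<^sub>R x))"
    by (rule linear_frechet_derivative[OF assms])
  have "((\<lambda>x. f (t *\<^sub>R x)) has_derivative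
      (\<lambda>v. frechet_derivative f (at (t *\<^sub>R x)) (t *\<^sub>R v))) (at x)"
    using assms[of "t *\<^sub>R x"] unfolding frechet_derivative_works
    by (rule has_derivative_compose[rotated]) (auto intro!: derivative_eq_intros)
  then have "((\<lambda>x. f (t *\<^sub>R x)) has_derivative
      (\<lambda>v. t * frechet_derivative f (at (t *\<^sub>R x)) v)) (at x)"
    by (simp add: scale)
  then show "frechet_derivative (\<lambda>x. f (t *\<^sub>R x)) (at x) =
      (\<lambda>v. t * frechet_derivative f (at (t *\<^sub>R x)) v)"
    and "(\<lambda>x. f (t *\<^sub>R x)) differentiable (at x)"
    by (auto intro: frechet_derivative_at[symmetric] simp: differentiable_def)
qed

lemma higher_differentiable_scaleR_arg:
  "higher_differentiable n f \<Longrightarrow> higher_differentiable n (\<lambda>x. f (t *\<^sub>R x))"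
proof (induction n arbitrary: f)
  case 0
  then show ?case by (auto intro!: continuous_on_compose2[of UNIV f] continuous_intros)
next
  case (Suc n)
  then show ?case
    by (auto simp: frechet_derivative_scaleR_arg
        intro!: higher_differentiable_mult higher_differentiable_const)
qed

lemma Cc_infinity_differentiable: "\<phi> \<in> Cc_infinity \<Longrightarrow> \<phi> differentiable (at x)"
  unfolding Cc_infinity_def by (auto dest!: spec[of _ "Suc 0"])

lemma Cc_infinity_continuous: "\<phi> \<in> Cc_infinity \<Longrightarrow> continuous_on UNIV \<phi>"
  unfolding Cc_infinity_def by (auto dest!: spec[of _ "0"])

lemma continuous_on_gradient: "\<phi> \<in> Cc_infinity \<Longrightarrow> continuous_on UNIV (gradient \<phi>)"
  unfolding Cc_infinity_def gradient_def
  by (auto dest!: spec[of _ "Suc 0"] intro!: continuous_intros)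

lemma gradient_eqI:
  assumes "\<And>v. frechet_derivative f (at z) v = v \<bullet> g"
  shows "gradient f z = g"
  by (simp add: gradient_def assms inner_commute[of _ g] euclidean_representation)

lemma frechet_derivative_eq_gradient:
  assumes "\<phi> differentiable (at z)"
  shows "frechet_derivative \<phi> (at z) v = v \<bullet> gradient \<phi> z"
  using frechet_derivative_at[of \<phi> "\<lambda>h. h \<bullet> gradient \<phi> z" z] GDERIV_gradient[OF assms]
  by (simp add: gderiv_def) metis

text \<open>
  A test function and its gradient vanish outside a common ball, because the complement of a
  closed ball is open.
\<close>

lemma Cc_infinity_bounded_support:
  fixes \<phi> :: "'a::euclidean_space \<Rightarrow> real"
  assumes "\<phi> \<in> Cc_infinity"
  obtains R C where "R > 0" "C \<ge> 0"
    "\<And>z. norm z > R \<Longrightarrow> \<phi> z = 0" "\<And>z. norm z > R \<Longrightarrow> gradient \<phi> z = 0"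
    "\<And>z. \<bar>\<phi> z\<bar> \<le> C" "\<And>z. norm (gradient \<phi> z) \<le> C"
proof -
  have "compact (closure {z. \<phi> z \<noteq> 0})" using assms by (simp add: Cc_infinity_def)
  then obtain R where R: "R > 0" "\<And>z. z \<in> closure {z. \<phi> z \<noteq> 0} \<Longrightarrow> norm z \<le> R"
    by (meson compact_imp_bounded bounded_pos)
  have z: "\<phi> z = 0" if "norm z > R" for z
    using R(2)[of z] that closure_subset[of "{z. \<phi> z \<noteq> 0}"] by force
  have g: "gradient \<phi> z = 0" if n: "norm z > R" for z
  proof (rule gradient_eqI)
    have "open {x. R < norm (x::'a)}" by (intro open_Collect_less continuous_intros)
    then have "(\<phi> has_derivative (\<lambda>_. 0)) (at z)"
      by (rule has_derivative_transform_within_open[OF has_derivative_const]) (use n z in auto)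
    from frechet_derivative_at[OF this, symmetric]
    show "frechet_derivative \<phi> (at z) v = v \<bullet> 0" for v by simp
  qed
  have b1: "bounded (\<phi> ` cball 0 R)" and b2: "bounded (gradient \<phi> ` cball 0 R)"
    using assms by (auto intro!: compact_imp_bounded compact_continuous_image
        continuous_on_subset[OF Cc_infinity_continuous]
        continuous_on_subset[OF continuous_on_gradient])
  from b1 obtain C1 where C1: "C1 > 0" "\<forall>x\<in>cball 0 R. \<bar>\<phi> x\<bar> \<le> C1"
    unfolding bounded_pos by auto
  from b2 obtain C2 where C2: "C2 > 0" "\<forall>x\<in>cball 0 R. norm (gradient \<phi> x) \<le> C2"
    unfolding bounded_pos by auto
  show thesis
  proof (rule that[of R "max C1 C2"])
    have "\<bar>\<phi> x\<bar> \<le> C1" "norm (gradient \<phi> x) \<le> C2" if "norm x \<le> R" for x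
      using C1 C2 that by auto
    then show "\<bar>\<phi> x\<bar> \<le> max C1 C2" "norm (gradient \<phi> x) \<le> max C1 C2" for x
      using z[of x] g[of x] C1 C2 by (cases "norm x \<le> R"; force simp: le_max_iff_disj)+
  qed (use R z g C1 in auto)
qed

lemma Cc_infinityI:
  assumes "\<And>n. higher_differentiable n \<phi>" "\<And>z. norm z > R \<Longrightarrow> \<phi> z = 0"
  shows "\<phi> \<in> Cc_infinity"
proof -
  have "{z. \<phi> z \<noteq> 0} \<subseteq> cball 0 R" using assms(2) by (force simp: not_less)
  then have "closure {z. \<phi> z \<noteq> 0} \<subseteq> cball 0 R" by (simp add: closure_minimal)
  then have "compact (closure {z. \<phi> z \<noteq> 0})"
    by (metis bounded_cball bounded_subset closed_closure compact_eq_bounded_closed)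
  then show ?thesis using assms(1) by (simp add: Cc_infinity_def)
qed

text \<open>
  For a suitable exponent \<open>\<kappa>\<close> the one-parameter group \<open>s \<mapsto> dilate \<kappa> s\<close> preserves a given
  homogeneous weighted integral. Vector-valued functions are included, since the gradient of a
  dilated function is a dilate of the gradient, with exponent \<open>\<kappa> + 1\<close>.
\<close>

definition dilate :: "real \<Rightarrow> real \<Rightarrow> ('a::real_vector \<Rightarrow> 'v::real_vector) \<Rightarrow> 'a \<Rightarrow> 'v" where
  "dilate \<kappa> s f z = exp (\<kappa> * s) *\<^sub>R f (exp s *\<^sub>R z)"

lemma dilate_Cc_infinity:
  assumes "\<phi> \<in> Cc_infinity" shows "dilate \<kappa> s \<phi> \<in> Cc_infinity"
proof -
  obtain R where R: "\<And>z. norm z > R \<Longrightarrow> \<phi> z = 0"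
    using Cc_infinity_bounded_support[OF assms] by metis
  show ?thesis
  proof (rule Cc_infinityI)
    show "higher_differentiable n (dilate \<kappa> s \<phi>)" for n
      using assms unfolding dilate_def[abs_def] Cc_infinity_def
      by (auto intro!: higher_differentiable_mult higher_differentiable_const
          higher_differentiable_scaleR_arg)
    show "dilate \<kappa> s \<phi> z = 0" if "norm z > R / exp s" for z
      using that by (auto simp: dilate_def R field_simps)
  qed
qed

lemma gradient_dilate:
  assumes "\<phi> \<in> Cc_infinity"
  shows "gradient (dilate \<kappa> s \<phi>) = dilate (\<kappa> + 1) s (gradient \<phi>)"
proof (rule ext, rule gradient_eqI)
  fix z v
  have "((\<lambda>z. \<phi> (exp s *\<^sub>R z)) has_derivative
      (\<lambda>v. exp s * frechet_derivative \<phi> (at (exp s *\<^sub>R z)) v)) (at z)"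
    using frechet_derivative_scaleR_arg[OF Cc_infinity_differentiable[OF assms]]
    by (metis frechet_derivative_works)
  from has_derivative_mult_right[OF this]
  have "frechet_derivative (dilate \<kappa> s \<phi>) (at z) =
     (\<lambda>v. exp (\<kappa> * s) * (exp s * frechet_derivative \<phi> (at (exp s *\<^sub>R z)) v))"
    unfolding dilate_def[abs_def] real_scaleR_def by (rule frechet_derivative_at[symmetric])
  then show "frechet_derivative (dilate \<kappa> s \<phi>) (at z) v = v \<bullet> dilate (\<kappa> + 1) s (gradient \<phi>) z"
    by (simp add: frechet_derivative_eq_gradient[OF Cc_infinity_differentiable[OF assms]]
        dilate_def algebra_simps exp_add)
qed

section \<open>Strict convexity of powers of the norm\<close>

text \<open>
  The difference of the two sides vanishes at \<open>1\<close>, decreases before and increases after it.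
\<close>

lemma powr_strictly_above_tangent:
  fixes x p :: real
  assumes "p > 1" "x \<ge> 0" "x \<noteq> 1"
  shows "x powr p > 1 + p * (x - 1)"
proof -
  define f where "f = (\<lambda>x. x powr p - 1 - p * (x - 1))"
  have d: "(f has_real_derivative p * (y powr (p - 1) - 1)) (at y)" if "y > 0" for y
    unfolding f_def using that by (auto intro!: derivative_eq_intros simp: algebra_simps)
  have c: "continuous_on {0..} f"
    unfolding f_def using assms by (auto intro!: continuous_intros continuous_on_powr')
  have "f x > f 1"
  proof (cases "x > 1")
    case True
    show ?thesis
    proof (rule DERIV_pos_imp_increasing_open[OF True])
      fix y :: real assume "1 < y" "y < x"
      then show "\<exists>z. (f has_real_derivative z) (at y) \<and> z > 0"
        using d[of y] assms by (intro exI[of _ "p * (y powr (p - 1) - 1)"]) (auto simp: gr_one_powr)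
    qed (auto intro: continuous_on_subset[OF c])
  next
    case False
    then have "x < 1" using assms by simp
    then show ?thesis
    proof (rule DERIV_neg_imp_decreasing_open)
      fix y :: real assume "x < y" "y < 1"
      then show "\<exists>z. (f has_real_derivative z) (at y) \<and> z < 0"
        using d[of y] assms powr_less_mono2[of "p - 1" y 1]
        by (intro exI[of _ "p * (y powr (p - 1) - 1)"]) (auto simp: mult_less_0_iff)
    qed (use assms in \<open>auto intro: continuous_on_subset[OF c]\<close>)
  qed
  then show ?thesis by (simp add: f_def)
qed

text \<open>
  Scaled to have mean \<open>1\<close>, this is the average of two tangent inequalities, of which one is strict
  unless the two numbers agree.
\<close>

lemma powr_strictly_convex:
  fixes x y p l m :: real
  assumes p: "p > 1" and x: "x \<ge> 0" and y: "y \<ge> 0"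
    and l: "l > 0" and m: "m > 0" and lm: "l + m = 1"
  shows "(l * x + m * y) powr p \<le> l * x powr p + m * y powr p"
    and "(l * x + m * y) powr p = l * x powr p + m * y powr p \<Longrightarrow> x = y"
proof -
  define s where "s = l * x + m * y"
  have *: "s powr p < l * x powr p + m * y powr p" if "x \<noteq> y"
  proof -
    have s0: "s > 0"
      using x y l m that unfolding s_def
      by (metis add_nonneg_nonneg add_nonneg_eq_0_iff mult_eq_0_iff mult_nonneg_nonneg
          less_eq_real_def order_less_irrefl)
    have "s \<noteq> x"
    proof
      assume "s = x"
      then have "m * y = (1 - l) * x" by (simp add: s_def algebra_simps)
      then show False using lm m that by (metis add_diff_cancel_left' mult_cancel_left order_less_irrefl)
    qed
    then have "(x / s) powr p > 1 + p * (x / s - 1)"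
      using s0 x p by (intro powr_strictly_above_tangent) auto
    moreover have "(y / s) powr p \<ge> 1 + p * (y / s - 1)"
      using s0 y p powr_strictly_above_tangent[of p "y / s"] by (cases "y / s = 1") auto
    ultimately have "l * (x / s) powr p + m * (y / s) powr p >
        l * (1 + p * (x / s - 1)) + m * (1 + p * (y / s - 1))"
      using l m by (intro add_less_le_mono mult_strict_left_mono mult_left_mono) auto
    also have "l * (1 + p * (x / s - 1)) + m * (1 + p * (y / s - 1)) =
        (l + m) + p * ((l * x + m * y) / s - (l + m))"
      by (simp add: algebra_simps add_divide_distrib)
    also have "(l * x + m * y) / s = 1" using s0 by (simp add: s_def)
    finally have "l * (x / s) powr p + m * (y / s) powr p > 1" using lm s0 by simp
    then show ?thesis using s0 x y by (simp add: powr_divide field_simps)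
  qed
  have eq: "s powr p = l * x powr p + m * y powr p" if "x = y"
    using that lm by (simp add: s_def flip: distrib_right)
  show "(l * x + m * y) powr p \<le> l * x powr p + m * y powr p"
    using * eq unfolding s_def by fastforce
  show "(l * x + m * y) powr p = l * x powr p + m * y powr p \<Longrightarrow> x = y"
    using * unfolding s_def by fastforce
qed

text \<open>
  Equality forces first equal norms, by strict convexity of the power, and then equal vectors: a proper
  convex combination of two distinct vectors of norm \<open>r\<close> has norm less than \<open>r\<close> in an inner product
  space.
\<close>

lemma norm_powr_strictly_convex:
  fixes P Q :: "'v::real_inner"
  assumes p: "p > 1" and l: "l > 0" and m: "m > 0" and lm: "l + m = 1"
  shows "norm (l *\<^sub>R P + m *\<^sub>R Q) powr p \<le> l * norm P powr p + m * norm Q powr p"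
    and "norm (l *\<^sub>R P + m *\<^sub>R Q) powr p = l * norm P powr p + m * norm Q powr p \<Longrightarrow> P = Q"
proof -
  have t: "norm (l *\<^sub>R P + m *\<^sub>R Q) \<le> l * norm P + m * norm Q"
    using norm_triangle_ineq[of "l *\<^sub>R P" "m *\<^sub>R Q"] l m by simp
  then have 1: "norm (l *\<^sub>R P + m *\<^sub>R Q) powr p \<le> (l * norm P + m * norm Q) powr p"
    using p by (intro powr_mono2) auto
  note 2 = powr_strictly_convex[OF p norm_ge_zero[of P] norm_ge_zero[of Q] l m lm]
  show "norm (l *\<^sub>R P + m *\<^sub>R Q) powr p \<le> l * norm P powr p + m * norm Q powr p"
    using 1 2(1) by linarith
  assume e: "norm (l *\<^sub>R P + m *\<^sub>R Q) powr p = l * norm P powr p + m * norm Q powr p"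
  then have pq: "norm P = norm Q" using 1 2 by linarith
  have pos: "0 \<le> l * norm P + m * norm Q" using l m by simp
  have "norm (l *\<^sub>R P + m *\<^sub>R Q) = l * norm P + m * norm Q"
    using t powr_less_mono2[of p "norm (l *\<^sub>R P + m *\<^sub>R Q)" "l * norm P + m * norm Q"] p e 2(1)
    by force
  also have "\<dots> = norm P" using pq lm by (simp flip: distrib_right)
  finally have "(norm (l *\<^sub>R P + m *\<^sub>R Q))\<^sup>2 = (norm P)\<^sup>2" by simp
  \<comment> \<open>The subtracted term is the gap in the convexity of the squared norm.\<close>
  moreover have "(norm (l *\<^sub>R P + m *\<^sub>R Q))\<^sup>2 =
      (l + m) * (l * (norm P)\<^sup>2 + m * (norm Q)\<^sup>2) - l * m * (norm (P - Q))\<^sup>2"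
    by (simp add: power2_norm_eq_inner inner_simps algebra_simps inner_commute)
  ultimately have "l * m * (norm (P - Q))\<^sup>2 = 0"
    using pq lm by (simp add: flip: distrib_right)
  then show "P = Q" using l m by simp
qed

text \<open>
  As \<open>\<theta> \<rightarrow> 0\<close> the first coefficient tends to \<open>1\<close>, so a perturbation \<open>y\<close> that is small in \<open>L\<^sup>p\<close>
  changes the norm of \<open>x\<close> only little. This replaces Minkowski's inequality.
\<close>

lemma norm_add_powr_le:
  fixes x y :: "'v::real_inner"
  assumes "p > 1" "0 < \<theta>" "\<theta> < 1"
  shows "norm (x + y) powr p \<le> (1 - \<theta>) powr (1 - p) * norm x powr p + \<theta> powr (1 - p) * norm y powr p"
proof -
  have e: "t * norm ((1/t) *\<^sub>R x) powr p = t powr (1 - p) * norm x powr p" if "t > 0" for t and x :: 'v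
    using that by (simp add: powr_diff powr_divide)
  have "norm ((1 - \<theta>) *\<^sub>R ((1/(1 - \<theta>)) *\<^sub>R x) + \<theta> *\<^sub>R ((1/\<theta>) *\<^sub>R y)) powr p
     \<le> (1 - \<theta>) * norm ((1/(1 - \<theta>)) *\<^sub>R x) powr p + \<theta> * norm ((1/\<theta>) *\<^sub>R y) powr p"
    by (rule norm_powr_strictly_convex(1)) (use assms in auto)
  moreover have "(1 - \<theta>) *\<^sub>R ((1/(1 - \<theta>)) *\<^sub>R x) + \<theta> *\<^sub>R ((1/\<theta>) *\<^sub>R y) = x + y"
    using assms by simp
  ultimately show ?thesis using assms e[of "1 - \<theta>" x] e[of \<theta> y] by simp
qed

section \<open>Power means of two test functions\<close>

text \<open>
  The \<open>p\<close>-mean of \<open>|P|\<close> and \<open>|Q|\<close>, regularised by \<open>\<epsilon>\<close> so that it becomes a smooth function of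
  \<open>P\<close> and \<open>Q\<close>.
\<close>

definition power_mean :: "real \<Rightarrow> real \<Rightarrow> real \<Rightarrow> real \<Rightarrow> real" where
  "power_mean p \<epsilon> P Q =
     (((P\<^sup>2 + \<epsilon>\<^sup>2) powr (p / 2) + (Q\<^sup>2 + \<epsilon>\<^sup>2) powr (p / 2)) / 2) powr (1 / p)"

text \<open>
  The gradient of the power mean of two functions with values \<open>P\<close>, \<open>Q\<close> and gradients \<open>X\<close>, \<open>Y\<close>.
  The formula is kept for \<open>\<epsilon> = 0\<close>, where \<open>0 powr r = 0\<close> makes the term of a vanishing function
  disappear.
\<close>

definition mean_gradient :: "real \<Rightarrow> real \<Rightarrow> real \<Rightarrow> real \<Rightarrow> 'v \<Rightarrow> 'v \<Rightarrow> 'v::real_vector" where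
  "mean_gradient p \<epsilon> P Q X Y =
     (power_mean p \<epsilon> P Q powr (1 - p) / 2) *\<^sub>R
       (((P\<^sup>2 + \<epsilon>\<^sup>2) powr (p / 2 - 1) * P) *\<^sub>R X + ((Q\<^sup>2 + \<epsilon>\<^sup>2) powr (p / 2 - 1) * Q) *\<^sub>R Y)"

text \<open>
  This is the source of the hidden convexity. The weights \<open>l\<close> and \<open>m\<close> are the shares of the two
  functions in the \<open>p\<close>-th power of their mean, and after division by the mean the two vectors on the
  right are (regularised) logarithmic gradients.
\<close>

lemma mean_gradient_convex_combination:
  fixes X Y :: "'v::real_vector"
  assumes p: "p > 1" and pos: "P\<^sup>2 + \<epsilon>\<^sup>2 > 0" "Q\<^sup>2 + \<epsilon>\<^sup>2 > 0"
  obtains l m where "l > 0" "m > 0" "l + m = 1"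
    "2 * l * power_mean p \<epsilon> P Q powr p = (P\<^sup>2 + \<epsilon>\<^sup>2) powr (p / 2)"
    "2 * m * power_mean p \<epsilon> P Q powr p = (Q\<^sup>2 + \<epsilon>\<^sup>2) powr (p / 2)"
    "mean_gradient p \<epsilon> P Q X Y =
       l *\<^sub>R ((power_mean p \<epsilon> P Q * P / (P\<^sup>2 + \<epsilon>\<^sup>2)) *\<^sub>R X) +
       m *\<^sub>R ((power_mean p \<epsilon> P Q * Q / (Q\<^sup>2 + \<epsilon>\<^sup>2)) *\<^sub>R Y)"
proof -
  define A where "A = (P\<^sup>2 + \<epsilon>\<^sup>2) powr (p / 2)"
  define B where "B = (Q\<^sup>2 + \<epsilon>\<^sup>2) powr (p / 2)"
  define M where "M = power_mean p \<epsilon> P Q"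
  have A: "A > 0" and B: "B > 0" using pos by (auto simp: A_def B_def)
  then have M: "M > 0" by (simp add: M_def power_mean_def flip: A_def B_def)
  have Mp: "M powr p = (A + B) / 2"
    using p A B by (simp add: M_def power_mean_def A_def B_def powr_powr)
  show thesis
  proof (rule that[of "A / (A + B)" "B / (A + B)"])
    have *: "M powr (1 - p) / 2 = M / (A + B)"
    proof -
      have "M powr (1 - p) = M / M powr p" using M by (simp add: powr_diff)
      then show ?thesis unfolding Mp using A B by (simp add: field_simps)
    qed
    show "mean_gradient p \<epsilon> P Q X Y =
       (A / (A + B)) *\<^sub>R ((power_mean p \<epsilon> P Q * P / (P\<^sup>2 + \<epsilon>\<^sup>2)) *\<^sub>R X) +
       (B / (A + B)) *\<^sub>R ((power_mean p \<epsilon> P Q * Q / (Q\<^sup>2 + \<epsilon>\<^sup>2)) *\<^sub>R Y)"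
      using pos
      by (simp add: mean_gradient_def * powr_diff[of _ "p / 2" 1] scaleR_add_right mult_ac flip: M_def A_def B_def)
    have AB: "A + B \<noteq> 0" using A B by simp
    show "A / (A + B) + B / (A + B) = 1" using AB by (simp flip: add_divide_distrib)
    show "2 * (A / (A + B)) * power_mean p \<epsilon> P Q powr p = (P\<^sup>2 + \<epsilon>\<^sup>2) powr (p / 2)"
      and "2 * (B / (A + B)) * power_mean p \<epsilon> P Q powr p = (Q\<^sup>2 + \<epsilon>\<^sup>2) powr (p / 2)"
      unfolding M_def[symmetric] A_def[symmetric] B_def[symmetric] Mp using AB by simp_all
  qed (use A B in auto)
qed

text \<open>
  Convexity of the \<open>p\<close>-th power of the norm is applied to the convex combination above. The weight
  \<open>l\<close> turns the \<open>p\<close>-th power of the first vector into at most half of that of \<open>X\<close>, since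
  \<open>|P| \<le> sqrt (P\<^sup>2 + \<epsilon>\<^sup>2)\<close>.
\<close>

lemma norm_mean_gradient_le:
  fixes X Y :: "'v::real_inner"
  assumes p: "p > 1" and \<epsilon>: "\<epsilon> > 0"
  shows "norm (mean_gradient p \<epsilon> P Q X Y) powr p \<le> (norm X powr p + norm Y powr p) / 2"
proof -
  have pos: "P\<^sup>2 + \<epsilon>\<^sup>2 > 0" "Q\<^sup>2 + \<epsilon>\<^sup>2 > 0" using \<epsilon> by (auto intro: add_nonneg_pos)
  define M where "M = power_mean p \<epsilon> P Q"
  have M: "M \<ge> 0" by (simp add: M_def power_mean_def)
  from mean_gradient_convex_combination[OF p pos, of X Y] obtain l m where lm: "l > 0" "m > 0" "l + m = 1"
    "2 * l * M powr p = (P\<^sup>2 + \<epsilon>\<^sup>2) powr (p / 2)"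
    "2 * m * M powr p = (Q\<^sup>2 + \<epsilon>\<^sup>2) powr (p / 2)"
    "mean_gradient p \<epsilon> P Q X Y =
       l *\<^sub>R ((M * P / (P\<^sup>2 + \<epsilon>\<^sup>2)) *\<^sub>R X) + m *\<^sub>R ((M * Q / (Q\<^sup>2 + \<epsilon>\<^sup>2)) *\<^sub>R Y)"
    unfolding M_def by metis
  have *: "l * norm ((M * P / (P\<^sup>2 + \<epsilon>\<^sup>2)) *\<^sub>R X) powr p \<le> norm X powr p / 2"
    if "P\<^sup>2 + \<epsilon>\<^sup>2 > 0" "2 * l * M powr p = (P\<^sup>2 + \<epsilon>\<^sup>2) powr (p / 2)" "l > 0" for l P and X :: 'v
  proof -
    define A where "A = sqrt (P\<^sup>2 + \<epsilon>\<^sup>2)"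
    have A: "A > 0" "P\<^sup>2 + \<epsilon>\<^sup>2 = A\<^sup>2" "\<bar>P\<bar> \<le> A"
      using that by (auto simp: A_def intro: real_le_rsqrt)
    have Ap: "(P\<^sup>2 + \<epsilon>\<^sup>2) powr (p / 2) = A powr p"
      using A by (simp add: powr_powr flip: powr_numeral)
    have "norm ((M * P / (P\<^sup>2 + \<epsilon>\<^sup>2)) *\<^sub>R X) \<le> M / A * norm X"
    proof -
      have "\<bar>P\<bar> / A\<^sup>2 \<le> 1 / A" using A by (simp add: field_simps power2_eq_square)
      then have "M * (\<bar>P\<bar> / A\<^sup>2) * norm X \<le> M * (1 / A) * norm X"
        using M by (intro mult_right_mono mult_left_mono) auto
      then show ?thesis using M A by (simp add: abs_mult)
    qed
    then have "norm ((M * P / (P\<^sup>2 + \<epsilon>\<^sup>2)) *\<^sub>R X) powr p \<le> (M / A * norm X) powr p"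
      using p by (intro powr_mono2) auto
    then have "l * norm ((M * P / (P\<^sup>2 + \<epsilon>\<^sup>2)) *\<^sub>R X) powr p \<le> l * (M / A * norm X) powr p"
      using that by (intro mult_left_mono) auto
    also have "\<dots> = (2 * l * M powr p) / A powr p * norm X powr p / 2"
      using A M by (simp add: powr_mult powr_divide)
    also have "\<dots> = norm X powr p / 2" unfolding that(2) Ap using A by simp
    finally show ?thesis .
  qed
  have "norm (mean_gradient p \<epsilon> P Q X Y) powr p \<le>
     l * norm ((M * P / (P\<^sup>2 + \<epsilon>\<^sup>2)) *\<^sub>R X) powr p + m * norm ((M * Q / (Q\<^sup>2 + \<epsilon>\<^sup>2)) *\<^sub>R Y) powr p"
    unfolding lm(6) by (rule norm_powr_strictly_convex(1)[OF p lm(1-3)])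
  also have "\<dots> \<le> norm X powr p / 2 + norm Y powr p / 2"
    using *[of P l X] *[of Q m Y] pos lm by (intro add_mono) auto
  finally show ?thesis by simp
qed

lemma power_mean_0:
  assumes "p > 1"
  shows "power_mean p 0 P Q powr p = (\<bar>P\<bar> powr p + \<bar>Q\<bar> powr p) / 2"
proof -
  have "(P\<^sup>2) powr (p / 2) = \<bar>P\<bar> powr p" for P :: real
  proof -
    have "(P\<^sup>2) powr (p / 2) = (\<bar>P\<bar> powr 2) powr (p / 2)" by simp
    then show ?thesis by (simp only: powr_powr) simp
  qed
  then show ?thesis using assms by (simp add: power_mean_def powr_powr)
qed

text \<open>
  If neither \<open>P\<close> nor \<open>Q\<close> vanishes, strict convexity makes the logarithmic gradients \<open>X / P\<close> and
  \<open>Y / Q\<close> equal. If only \<open>P\<close> vanishes, then the mean has gradient norm \<open>|Y| / 2\<^sup>1\<^sup>/\<^sup>p\<close>, so equality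
  leaves no room for a nonzero \<open>X\<close>. The cross-multiplied form covers all cases.
\<close>

lemma mean_gradient_eq_imp_proportional:
  fixes X Y :: "'v::real_inner"
  assumes p: "p > 1" and nz: "P \<noteq> 0 \<or> Q \<noteq> 0"
    and eq: "norm (mean_gradient p 0 P Q X Y) powr p = (norm X powr p + norm Y powr p) / 2"
  shows "Q *\<^sub>R X = P *\<^sub>R Y"
proof -
  define M where "M = power_mean p 0 P Q"
  have M: "M \<ge> 0" by (simp add: M_def power_mean_def)
  have Mp: "M powr p = (\<bar>P\<bar> powr p + \<bar>Q\<bar> powr p) / 2" using power_mean_0[OF p] by (simp add: M_def)
  have sq: "(P\<^sup>2) powr (r / 2) = \<bar>P\<bar> powr r" for P r :: real
  proof -
    have "(P\<^sup>2) powr (r / 2) = (\<bar>P\<bar> powr 2) powr (r / 2)" by simp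
    then show ?thesis by (simp only: powr_powr) simp
  qed
  consider "P = 0" "Q \<noteq> 0" | "P \<noteq> 0" "Q = 0" | "P \<noteq> 0" "Q \<noteq> 0" using nz by auto
  then show ?thesis
  proof cases
    case 3
    from mean_gradient_convex_combination[OF p, of P 0 Q X Y] 3 obtain l m where lm:
      "l > 0" "m > 0" "l + m = 1"
      "2 * l * M powr p = (P\<^sup>2) powr (p / 2)"
      "2 * m * M powr p = (Q\<^sup>2) powr (p / 2)"
      "mean_gradient p 0 P Q X Y =
         l *\<^sub>R ((M * P / (P\<^sup>2)) *\<^sub>R X) + m *\<^sub>R ((M * Q / (Q\<^sup>2)) *\<^sub>R Y)"
      unfolding M_def by auto
    have *: "l * norm ((M * P / (P\<^sup>2)) *\<^sub>R X) powr p = norm X powr p / 2"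
      if "P \<noteq> 0" "2 * l * M powr p = (P\<^sup>2) powr (p / 2)" for l P and X :: 'v
    proof -
      have "norm ((M * P / (P\<^sup>2)) *\<^sub>R X) = M / \<bar>P\<bar> * norm X"
        using M that by (simp add: abs_mult power2_eq_square field_simps)
      then have "l * norm ((M * P / (P\<^sup>2)) *\<^sub>R X) powr p =
          (2 * l * M powr p) / \<bar>P\<bar> powr p * norm X powr p / 2"
        using M that(1) by (simp add: powr_mult powr_divide)
      then show ?thesis unfolding that(2) using that(1) by (simp add: sq)
    qed
    have "(M * P / (P\<^sup>2)) *\<^sub>R X = (M * Q / (Q\<^sup>2)) *\<^sub>R Y"
    proof (rule norm_powr_strictly_convex(2)[OF p lm(1-3)])
      show "norm (l *\<^sub>R ((M * P / (P\<^sup>2)) *\<^sub>R X) + m *\<^sub>R ((M * Q / (Q\<^sup>2)) *\<^sub>R Y)) powr p =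
         l * norm ((M * P / (P\<^sup>2)) *\<^sub>R X) powr p + m * norm ((M * Q / (Q\<^sup>2)) *\<^sub>R Y) powr p"
        using eq *[of P l X] *[of Q m Y] 3 lm by simp
    qed
    moreover have "M > 0" using Mp 3 M
      by (metis add_pos_pos half_gt_zero less_eq_real_def powr_0 powr_gt_zero zero_less_abs_iff order_less_irrefl powr_eq_0_iff)
    ultimately have "(P * Q / M) *\<^sub>R ((M * P / P\<^sup>2) *\<^sub>R X) = (P * Q / M) *\<^sub>R ((M * Q / Q\<^sup>2) *\<^sub>R Y)"
      and "M > 0" by auto
    then show ?thesis using 3 by (simp add: power2_eq_square)
  next
    case 1
    have m: "M powr p = \<bar>Q\<bar> powr p / 2" using Mp 1 p by simp
    have "M \<noteq> 0" using m 1 by auto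
    have M0: "power_mean p 0 0 Q = M" using 1 by (simp add: M_def)
    have "norm (mean_gradient p 0 P Q X Y) = M powr (1 - p) / 2 * (\<bar>Q\<bar> powr p / \<bar>Q\<bar>) * norm Y"
      using 1 sq[of Q p] M0 by (simp add: mean_gradient_def powr_diff[of _ "p / 2" 1] abs_mult power2_eq_square)
    also have "\<dots> = M / \<bar>Q\<bar> * norm Y" using m \<open>M \<noteq> 0\<close> 1 M by (simp add: powr_diff field_simps)
    finally have "norm (mean_gradient p 0 P Q X Y) powr p = M powr p / \<bar>Q\<bar> powr p * norm Y powr p"
      using M by (simp add: powr_mult powr_divide)
    then have "norm (mean_gradient p 0 P Q X Y) powr p = norm Y powr p / 2"
      unfolding m using 1 by simp
    then show ?thesis using eq 1 by simp
  next
    case 2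
    have m: "M powr p = \<bar>P\<bar> powr p / 2" using Mp 2 p by simp
    have "M \<noteq> 0" using m 2 by auto
    have M0: "power_mean p 0 P 0 = M" using 2 by (simp add: M_def)
    have "norm (mean_gradient p 0 P Q X Y) = M powr (1 - p) / 2 * (\<bar>P\<bar> powr p / \<bar>P\<bar>) * norm X"
      using 2 sq[of P p] M0 by (simp add: mean_gradient_def powr_diff[of _ "p / 2" 1] abs_mult power2_eq_square)
    also have "\<dots> = M / \<bar>P\<bar> * norm X" using m \<open>M \<noteq> 0\<close> 2 M by (simp add: powr_diff field_simps)
    finally have "norm (mean_gradient p 0 P Q X Y) powr p = M powr p / \<bar>P\<bar> powr p * norm X powr p"
      using M by (simp add: powr_mult powr_divide)
    then have "norm (mean_gradient p 0 P Q X Y) powr p = norm X powr p / 2"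
      unfolding m using 2 by simp
    then show ?thesis using eq 2 by simp
  qed
qed

lemma tendsto_power_mean:
  assumes "p > 1" "(\<epsilon> \<longlongrightarrow> 0) F" "(P \<longlongrightarrow> P0) F" "(Q \<longlongrightarrow> Q0) F"
  shows "((\<lambda>n. power_mean p (\<epsilon> n) (P n) (Q n)) \<longlongrightarrow> power_mean p 0 P0 Q0) F"
  unfolding power_mean_def using assms
  by (intro tendsto_powr' tendsto_intros) (auto intro!: tendsto_eq_intros)

text \<open>
  For \<open>p < 2\<close> the first factor may blow up where \<open>P\<close> and \<open>\<epsilon>\<close> tend to \<open>0\<close>; the product is still at
  most \<open>(P\<^sup>2 + \<epsilon>\<^sup>2)\<^sup>(\<^sup>p\<^sup>-\<^sup>1\<^sup>)\<^sup>/\<^sup>2\<close>, which tends to \<open>0\<close>.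
\<close>

lemma tendsto_duality_map:
  fixes P \<epsilon> :: "'i \<Rightarrow> real"
  assumes p: "p > 1" and \<epsilon>: "(\<epsilon> \<longlongrightarrow> 0) F" and P: "(P \<longlongrightarrow> P0) F"
  shows "((\<lambda>n. ((P n)\<^sup>2 + (\<epsilon> n)\<^sup>2) powr (p / 2 - 1) * P n) \<longlongrightarrow> (P0\<^sup>2 + 0\<^sup>2) powr (p / 2 - 1) * P0) F"
proof (cases "P0 = 0")
  case False
  then show ?thesis using assms by (intro tendsto_mult tendsto_powr tendsto_add tendsto_power) auto
next
  case True
  have "((\<lambda>n. ((P n)\<^sup>2 + (\<epsilon> n)\<^sup>2) powr ((p - 1) / 2)) \<longlongrightarrow> (P0\<^sup>2 + 0\<^sup>2) powr ((p - 1) / 2)) F"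
    using assms by (intro tendsto_powr' tendsto_intros) auto
  then have z: "((\<lambda>n. ((P n)\<^sup>2 + (\<epsilon> n)\<^sup>2) powr ((p - 1) / 2)) \<longlongrightarrow> 0) F" using True by simp
  have "norm ((P\<^sup>2 + e\<^sup>2) powr (p / 2 - 1) * P) \<le> (P\<^sup>2 + e\<^sup>2) powr ((p - 1) / 2)" for P e :: real
  proof -
    have "\<bar>P\<bar> \<le> (P\<^sup>2 + e\<^sup>2) powr (1 / 2)" by (simp add: powr_half_sqrt real_le_rsqrt)
    then have "(P\<^sup>2 + e\<^sup>2) powr (p / 2 - 1) * \<bar>P\<bar> \<le> (P\<^sup>2 + e\<^sup>2) powr (p / 2 - 1) * (P\<^sup>2 + e\<^sup>2) powr (1 / 2)"
      by (intro mult_left_mono) auto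
    then show ?thesis by (simp add: abs_mult field_simps flip: powr_add)
  qed
  then show ?thesis using True by (simp add: tendsto_0_le[OF z, of _ 1])
qed

lemma tendsto_mean_gradient:
  fixes X Y :: "'i \<Rightarrow> 'v::real_normed_vector"
  assumes p: "p > 1" and "(\<epsilon> \<longlongrightarrow> 0) F" "(P \<longlongrightarrow> P0) F" "(Q \<longlongrightarrow> Q0) F"
    and "(X \<longlongrightarrow> X0) F" "(Y \<longlongrightarrow> Y0) F" and nz: "P0 \<noteq> 0 \<or> Q0 \<noteq> 0"
  shows "((\<lambda>n. mean_gradient p (\<epsilon> n) (P n) (Q n) (X n) (Y n)) \<longlongrightarrow> mean_gradient p 0 P0 Q0 X0 Y0) F"
proof -
  have "power_mean p 0 P0 Q0 powr p > 0"
    unfolding power_mean_0[OF p] using nz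
    by (metis add_nonneg_pos add_pos_nonneg half_gt_zero powr_ge_zero powr_gt_zero zero_less_abs_iff
        less_irrefl)
  then have "power_mean p 0 P0 Q0 \<noteq> 0" by auto
  then show ?thesis unfolding mean_gradient_def using assms
    by (intro tendsto_scaleR tendsto_add tendsto_divide tendsto_duality_map tendsto_powr
        tendsto_power_mean tendsto_const) auto
qed

lemma power_mean_at_0:
  assumes "p > 1" "\<epsilon> \<ge> 0" shows "power_mean p \<epsilon> 0 0 = \<epsilon>"
  using assms by (simp add: power_mean_def powr_powr flip: powr_numeral)

text \<open>
  Subtracting \<open>\<epsilon>\<close> restores the compact support: the mean equals \<open>\<epsilon>\<close> where both functions
  vanish.
\<close>

lemma power_mean_Cc_infinity:
  fixes f g :: "'a::euclidean_space \<Rightarrow> real"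
  assumes p: "p > 1" and \<epsilon>: "\<epsilon> > 0" and f: "f \<in> Cc_infinity" and g: "g \<in> Cc_infinity"
  shows "(\<lambda>z. power_mean p \<epsilon> (f z) (g z) - \<epsilon>) \<in> Cc_infinity"
    and "gradient (\<lambda>z. power_mean p \<epsilon> (f z) (g z) - \<epsilon>) z =
      mean_gradient p \<epsilon> (f z) (g z) (gradient f z) (gradient g z)"
proof -
  have pos: "x\<^sup>2 + \<epsilon>\<^sup>2 > 0" for x using \<epsilon> by (auto intro: add_nonneg_pos)
  have pos2: "((x\<^sup>2 + \<epsilon>\<^sup>2) powr (p / 2) + (y\<^sup>2 + \<epsilon>\<^sup>2) powr (p / 2)) / 2 > 0" for x y
    using \<epsilon> by (auto intro!: add_pos_pos)
  obtain R1 where R1: "\<And>z. norm z > R1 \<Longrightarrow> f z = 0"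
    using Cc_infinity_bounded_support[OF f] by metis
  obtain R2 where R2: "\<And>z. norm z > R2 \<Longrightarrow> g z = 0"
    using Cc_infinity_bounded_support[OF g] by metis
  show "(\<lambda>z. power_mean p \<epsilon> (f z) (g z) - \<epsilon>) \<in> Cc_infinity"
  proof (rule Cc_infinityI)
    fix n
    have fg: "higher_differentiable n f" "higher_differentiable n g"
      using f g by (auto simp: Cc_infinity_def)
    have A: "higher_differentiable n (\<lambda>z. (h z * h z + \<epsilon>\<^sup>2) powr (p / 2))"
      if "higher_differentiable n h" for h :: "'a \<Rightarrow> real"
      using that pos by (intro higher_differentiable_powr higher_differentiable_add
          higher_differentiable_mult higher_differentiable_const) (auto simp: power2_eq_square)
    have "higher_differentiable n (\<lambda>z. (((f z * f z + \<epsilon>\<^sup>2) powr (p / 2) +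
       (g z * g z + \<epsilon>\<^sup>2) powr (p / 2)) * (1 / 2)) powr (1 / p) + (- \<epsilon>))"
      using pos2 fg by (intro higher_differentiable_powr higher_differentiable_add A
          higher_differentiable_mult higher_differentiable_const) (auto simp: power2_eq_square)
    then show "higher_differentiable n (\<lambda>z. power_mean p \<epsilon> (f z) (g z) - \<epsilon>)"
      by (simp add: power_mean_def power2_eq_square)
  next
    fix z :: 'a assume "norm z > max R1 R2"
    then show "power_mean p \<epsilon> (f z) (g z) - \<epsilon> = 0"
      using R1 R2 p \<epsilon> by (simp add: power_mean_at_0)
  qed
  show "gradient (\<lambda>z. power_mean p \<epsilon> (f z) (g z) - \<epsilon>) z =
      mean_gradient p \<epsilon> (f z) (g z) (gradient f z) (gradient g z)"
  proof (rule gradient_eqI)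
    fix v
    let ?f = "frechet_derivative f (at z)" and ?g = "frechet_derivative g (at z)"
    have df: "(f has_derivative ?f) (at z)" "(g has_derivative ?g) (at z)"
      using Cc_infinity_differentiable[OF f] Cc_infinity_differentiable[OF g]
      by (auto simp: frechet_derivative_works)
    have A: "((\<lambda>z. ((h z)\<^sup>2 + \<epsilon>\<^sup>2) powr (p / 2)) has_derivative
        (\<lambda>v. p * (((h z)\<^sup>2 + \<epsilon>\<^sup>2) powr (p / 2 - 1) * h z) * h' v)) (at z)"
      if h: "(h has_derivative h') (at z)" for h :: "'a \<Rightarrow> real" and h'
    proof -
      have "((\<lambda>z. (h z)\<^sup>2 + \<epsilon>\<^sup>2) has_derivative (\<lambda>v. 2 * h z * h' v)) (at z)"
        by (auto intro!: derivative_eq_intros h)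
      from has_derivative_powr_const[OF this pos, of "p / 2"] show ?thesis
        by (simp add: mult_ac)
    qed
    have half: "((\<lambda>z. h z / 2) has_derivative (\<lambda>v. h' v / 2)) (at z)"
      if h: "(h has_derivative h') (at z)" for h :: "'a \<Rightarrow> real" and h'
      by (auto intro!: derivative_eq_intros h)
    let ?r = "((f z)\<^sup>2 + \<epsilon>\<^sup>2) powr (p / 2) + ((g z)\<^sup>2 + \<epsilon>\<^sup>2) powr (p / 2)"
    have "((\<lambda>z. power_mean p \<epsilon> (f z) (g z) - \<epsilon>) has_derivative
       (\<lambda>v. (1 / p) * (?r / 2) powr (1 / p - 1) *
         ((p * (((f z)\<^sup>2 + \<epsilon>\<^sup>2) powr (p / 2 - 1) * f z) * ?f v +
           p * (((g z)\<^sup>2 + \<epsilon>\<^sup>2) powr (p / 2 - 1) * g z) * ?g v) / 2) - 0)) (at z)"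
      unfolding power_mean_def
      by (intro has_derivative_diff has_derivative_const has_derivative_powr_const half
          has_derivative_add A df pos2)
    then have "frechet_derivative (\<lambda>z. power_mean p \<epsilon> (f z) (g z) - \<epsilon>) (at z) =
       (\<lambda>v. (1 / p) * (?r / 2) powr (1 / p - 1) *
         ((p * (((f z)\<^sup>2 + \<epsilon>\<^sup>2) powr (p / 2 - 1) * f z) * ?f v +
           p * (((g z)\<^sup>2 + \<epsilon>\<^sup>2) powr (p / 2 - 1) * g z) * ?g v) / 2) - 0)"
      by (rule frechet_derivative_at[symmetric])
    then have 1: "frechet_derivative (\<lambda>z. power_mean p \<epsilon> (f z) (g z) - \<epsilon>) (at z) v =
       (?r / 2) powr (1 / p - 1) / 2 *
         ((((f z)\<^sup>2 + \<epsilon>\<^sup>2) powr (p / 2 - 1) * f z) * ?f v +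
           (((g z)\<^sup>2 + \<epsilon>\<^sup>2) powr (p / 2 - 1) * g z) * ?g v)"
      using p by (simp add: field_simps)
    have "power_mean p \<epsilon> (f z) (g z) powr (1 - p) = (?r / 2) powr (1 / p - 1)"
      using p by (simp add: power_mean_def powr_powr diff_divide_distrib)
    then show "frechet_derivative (\<lambda>z. power_mean p \<epsilon> (f z) (g z) - \<epsilon>) (at z) v =
        v \<bullet> mean_gradient p \<epsilon> (f z) (g z) (gradient f z) (gradient g z)"
      unfolding 1 mean_gradient_def
      by (simp add: inner_simps frechet_derivative_eq_gradient Cc_infinity_differentiable f g)
  qed
qed

text \<open>
  This is the limit \<open>\<epsilon> \<rightarrow> 0\<close> of the regularised inequality.
\<close>

lemma norm_mean_gradient_0_le:
  fixes X Y :: "'v::real_inner"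
  assumes p: "p > 1" and nz: "P \<noteq> 0 \<or> Q \<noteq> 0"
  shows "norm (mean_gradient p 0 P Q X Y) powr p \<le> (norm X powr p + norm Y powr p) / 2"
proof (rule LIMSEQ_le_const2)
  have "(\<lambda>n. mean_gradient p (1 / real (Suc n)) P Q X Y) \<longlonglongrightarrow> mean_gradient p 0 P Q X Y"
    using LIMSEQ_Suc[OF lim_1_over_n] by (intro tendsto_mean_gradient p nz tendsto_const) simp
  then show "(\<lambda>n. norm (mean_gradient p (1 / real (Suc n)) P Q X Y) powr p) \<longlonglongrightarrow>
      norm (mean_gradient p 0 P Q X Y) powr p"
    using p by (intro tendsto_powr' tendsto_norm tendsto_const) auto
  show "\<exists>N. \<forall>n\<ge>N. norm (mean_gradient p (1 / real (Suc n)) P Q X Y) powr p \<le>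
      (norm X powr p + norm Y powr p) / 2"
    by (intro exI[of _ 0] allI impI norm_mean_gradient_le p) simp
qed

lemma measurable_mean_gradient [measurable]:
  fixes X Y :: "'a \<Rightarrow> 'v::euclidean_space"
  assumes [measurable]: "P \<in> borel_measurable M" "Q \<in> borel_measurable M"
    "X \<in> borel_measurable M" "Y \<in> borel_measurable M"
  shows "(\<lambda>z. mean_gradient p \<epsilon> (P z) (Q z) (X z) (Y z)) \<in> borel_measurable M"
  unfolding mean_gradient_def power_mean_def by measurable

lemma measurable_power_mean [measurable]:
  assumes [measurable]: "P \<in> borel_measurable M" "Q \<in> borel_measurable M"
  shows "(\<lambda>z. power_mean p \<epsilon> (P z) (Q z)) \<in> borel_measurable M"
  unfolding power_mean_def by measurable

section \<open>Weighted integrals and dilation invariance\<close>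

lemma nn_integral_lborel_scaleR:
  fixes f :: "'a::euclidean_space \<Rightarrow> ennreal"
  assumes [measurable]: "f \<in> borel_measurable borel" and c: "c > 0"
  shows "(\<integral>\<^sup>+z. f z \<partial>lborel) = ennreal (c ^ DIM('a)) * (\<integral>\<^sup>+z. f (c *\<^sub>R z) \<partial>lborel)"
proof -
  have "(\<integral>\<^sup>+z. f z \<partial>lborel) =
    (\<integral>\<^sup>+z. f z \<partial>(density (distr lborel borel (\<lambda>x::'a. 0 + c *\<^sub>R x)) (\<lambda>_. \<bar>c\<bar>^DIM('a))))"
    using lborel_affine[of c "0::'a"] c by simp
  also have "\<dots> = ennreal (c ^ DIM('a)) * (\<integral>\<^sup>+z. f (c *\<^sub>R z) \<partial>lborel)"
    using c by (simp add: nn_integral_density nn_integral_distr nn_integral_cmult)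
  finally show ?thesis .
qed

lemma AE_lborel_scaleR:
  fixes P :: "'a::euclidean_space \<Rightarrow> bool"
  assumes "AE z in lborel. P z" and c: "c > 0"
  shows "AE z in lborel. P (c *\<^sub>R z)"
proof -
  obtain N where N: "N \<in> null_sets lborel" "{z. \<not> P z} \<subseteq> N"
    using assms(1) by (auto elim!: AE_E simp: null_sets_def)
  then have [measurable]: "N \<in> sets borel" by (auto simp: null_sets_def)
  have "0 = ennreal (c ^ DIM('a)) * (\<integral>\<^sup>+z. indicator N (c *\<^sub>R z::'a) \<partial>lborel)"
    using nn_integral_lborel_scaleR[OF _ c, of "indicator N"] N by (simp add: null_sets_def)
  then have "(\<integral>\<^sup>+z. indicator N (c *\<^sub>R z::'a) \<partial>lborel) = 0" using c by auto
  then have "AE z in lborel. indicator N (c *\<^sub>R z::'a) = (0::ennreal)"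
    by (subst (asm) nn_integral_0_iff_AE) auto
  then show ?thesis
    by (rule eventually_mono) (use N in \<open>auto simp: indicator_def split: if_splits\<close>)
qed

definition weight :: "real \<Rightarrow> real \<Rightarrow> 'k::euclidean_space \<times> 'm::euclidean_space \<Rightarrow> real" where
  "weight \<alpha> \<beta> z = norm (fst z) powr \<alpha> * norm z powr \<beta>"

lemma weight_nonneg [simp]: "weight \<alpha> \<beta> z \<ge> 0"
  by (simp add: weight_def)

lemma weight_eq_0_iff: "weight \<alpha> \<beta> z = 0 \<longleftrightarrow> fst z = 0"
  by (cases z) (auto simp: weight_def zero_prod_def)

lemma measurable_weight [measurable]: "weight \<alpha> \<beta> \<in> borel_measurable borel"
proof -
  have [measurable]: "(\<lambda>z::'a \<times> 'b. norm (fst z)) \<in> borel_measurable borel"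
    by (intro borel_measurable_continuous_onI continuous_intros)
  show ?thesis unfolding weight_def[abs_def] by measurable
qed

lemma weighted_integral_weight:
  "weighted_integral \<alpha> \<beta> p f = (\<integral>\<^sup>+z. ennreal (weight \<alpha> \<beta> z * norm (f z) powr p) \<partial>lborel)"
  by (simp add: weighted_integral_def weight_def)

lemma weight_scaleR: "c > 0 \<Longrightarrow> weight \<alpha> \<beta> (c *\<^sub>R z) = c powr (\<alpha> + \<beta>) * weight \<alpha> \<beta> z"
  by (simp add: weight_def powr_mult powr_add)

lemma measurable_dilate [measurable]:
  fixes f :: "'a::euclidean_space \<Rightarrow> 'v::euclidean_space"
  assumes [measurable]: "f \<in> borel_measurable borel"
  shows "dilate \<kappa> s f \<in> borel_measurable borel"
  unfolding dilate_def[abs_def] by measurable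

text \<open>
  Under \<open>z \<mapsto> e\<^sup>s z\<close> Lebesgue measure and the weight contribute \<open>e\<^sup>s\<^sup>(\<^sup>d\<^sup>+\<^sup>\<alpha>\<^sup>+\<^sup>\<beta>\<^sup>)\<close>, which the
  prefactor of the dilation compensates for this choice of \<open>\<kappa>\<close>.
\<close>

lemma weighted_integral_dilate:
  fixes f :: "'k::euclidean_space \<times> 'm::euclidean_space \<Rightarrow> 'v::euclidean_space"
  assumes [measurable]: "f \<in> borel_measurable borel"
    and \<kappa>: "\<kappa> * p = real DIM('k \<times> 'm) + \<alpha> + \<beta>"
  shows "weighted_integral \<alpha> \<beta> p (dilate \<kappa> s f) = weighted_integral \<alpha> \<beta> p f"
proof -
  define F where "F z = ennreal (weight \<alpha> \<beta> z * norm (f z) powr p)" for z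
  have [measurable]: "F \<in> borel_measurable borel" unfolding F_def[abs_def] by measurable
  have "ennreal (weight \<alpha> \<beta> z * norm (dilate \<kappa> s f z) powr p) =
      ennreal (exp s ^ DIM('k \<times> 'm)) * F (exp s *\<^sub>R z)" for z
  proof -
    have "exp (\<kappa> * s) powr p = exp (s * (\<kappa> * p))" by (simp add: powr_def mult_ac)
    also have "\<dots> = exp s ^ DIM('k \<times> 'm) * exp s powr (\<alpha> + \<beta>)"
      unfolding \<kappa> by (simp add: powr_def algebra_simps exp_add flip: exp_of_nat_mult)
    finally have "weight \<alpha> \<beta> z * norm (dilate \<kappa> s f z) powr p =
        exp s ^ DIM('k \<times> 'm) * (weight \<alpha> \<beta> (exp s *\<^sub>R z) * norm (f (exp s *\<^sub>R z)) powr p)"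
      by (simp add: dilate_def powr_mult weight_scaleR del: DIM_prod)
    then show ?thesis by (simp add: F_def ennreal_mult del: DIM_prod)
  qed
  then show ?thesis
    unfolding weighted_integral_weight F_def[symmetric]
    by (subst nn_integral_lborel_scaleR[of F "exp s"]) (auto simp: nn_integral_cmult simp del: DIM_prod)
qed

section \<open>Finiteness of weighted integrals of test functions\<close>

text \<open>
  The punctured ball is the union of dyadic annuli, and halving the radius multiplies the integral over
  an annulus by \<open>2\<^sup>-\<^sup>(\<^sup>d\<^sup>+\<^sup>q\<^sup>) < 1\<close>. The integral is thus bounded by a geometric series. The statement
  serves both for \<open>|y|\<^sup>\<alpha>\<close> on the first factor and for the full weight on the product space.
\<close>

lemma homogeneous_integrable_near_0:
  fixes f :: "'a::euclidean_space \<Rightarrow> ennreal"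
  assumes [measurable]: "f \<in> borel_measurable borel" and R: "R > 0"
    and hom: "\<And>z. f ((1/2) *\<^sub>R z) = ennreal (2 powr (- q)) * f z" and q: "real DIM('a) + q > 0"
    and fin: "(\<integral>\<^sup>+z. f z * indicator {z. R / 2 < norm z \<and> norm z \<le> R} z \<partial>lborel) < top"
  shows "(\<integral>\<^sup>+z. f z * indicator {z. 0 < norm z \<and> norm z \<le> R} z \<partial>lborel) < top"
proof -
  define A where "A j = {z::'a. R / 2 ^ Suc j < norm z \<and> norm z \<le> R / 2 ^ j}" for j :: nat
  have [measurable]: "A j \<in> sets borel" for j unfolding A_def by measurable
  define \<theta> where "\<theta> = 2 powr (- (DIM('a) + q))"
  have \<theta>: "0 \<le> \<theta>" "\<theta> < 1" using q by (auto simp: \<theta>_def powr_less_one)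
  define J where "J = (\<integral>\<^sup>+z. f z * indicator (A 0) z \<partial>lborel)"
  have J: "J < top" using fin by (simp add: J_def A_def)
  have step: "(\<integral>\<^sup>+z. f z * indicator (A j) z \<partial>lborel) = ennreal (\<theta> ^ j) * J" for j
  proof (induction j)
    case (Suc j)
    have "indicator (A (Suc j)) ((1/2) *\<^sub>R z) = (indicator (A j) z :: ennreal)" for z
      by (auto simp: indicator_def A_def field_simps)
    then have "(\<integral>\<^sup>+z. f z * indicator (A (Suc j)) z \<partial>lborel) =
      ennreal ((1/2) ^ DIM('a)) * (\<integral>\<^sup>+z. ennreal (2 powr (- q)) * (f z * indicator (A j) z) \<partial>lborel)"
      by (subst nn_integral_lborel_scaleR[of _ "1/2"]) (auto simp: hom mult.assoc)
    also have "(\<integral>\<^sup>+z. ennreal (2 powr (- q)) * (f z * indicator (A j) z) \<partial>lborel) =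
        ennreal (2 powr (- q)) * (ennreal (\<theta> ^ j) * J)"
      by (subst nn_integral_cmult) (auto simp: Suc)
    also have "ennreal ((1/2) ^ DIM('a)) * (ennreal (2 powr (- q)) * (ennreal (\<theta> ^ j) * J)) =
        ennreal ((1/2) ^ DIM('a) * 2 powr (- q)) * (ennreal (\<theta> ^ j) * J)"
      by (subst ennreal_mult) (auto simp: mult_ac)
    also have "(1/2) ^ DIM('a) * 2 powr (- q) = \<theta>"
      by (simp add: \<theta>_def powr_diff powr_minus powr_add powr_realpow power_one_over field_simps)
    finally show ?case using \<theta> by (simp add: ennreal_mult mult_ac)
  qed (simp add: J_def)
  have cover: "indicator {z. 0 < norm z \<and> norm z \<le> R} z \<le> (\<Sum>j. indicator (A j) z :: ennreal)" for z
  proof (cases "0 < norm z \<and> norm z \<le> R")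
    case True
    then obtain n where n: "(1/2) ^ n < norm z / R"
      using real_arch_pow_inv[of "norm z / R" "1/2"] R by auto
    have "\<exists>k<n. (\<forall>i\<le>k. \<not> R / 2 ^ i < norm z) \<and> R / 2 ^ (k + 1) < norm z"
      using ex_least_nat_less[of "\<lambda>n. R / 2 ^ n < norm z" n] n R True
      by (auto simp: field_simps power_one_over)
    then obtain k where "z \<in> A k" by (auto simp: A_def not_less)
    then have "(1::ennreal) \<le> (\<Sum>j\<in>{k}. indicator (A j) z)" by simp
    also have "\<dots> \<le> (\<Sum>j. indicator (A j) z)" by (intro sum_le_suminf) auto
    finally show ?thesis using True by simp
  qed auto
  have "(\<integral>\<^sup>+z. f z * indicator {z. 0 < norm z \<and> norm z \<le> R} z \<partial>lborel)
      \<le> (\<integral>\<^sup>+z. (\<Sum>j. f z * indicator (A j) z) \<partial>lborel)"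
    using cover by (intro nn_integral_mono) (simp add: mult_left_mono)
  also have "\<dots> = (\<Sum>j. \<integral>\<^sup>+z. f z * indicator (A j) z \<partial>lborel)"
    by (intro nn_integral_suminf) auto
  also have "\<dots> = (\<Sum>j. ennreal (\<theta> ^ j)) * J" unfolding step by simp
  also have "(\<Sum>j. ennreal (\<theta> ^ j)) = ennreal (\<Sum>j. \<theta> ^ j)"
    using \<theta> by (intro suminf_ennreal2) (auto simp: summable_geometric)
  finally show ?thesis using J by (auto simp: ennreal_mult_less_top intro: le_less_trans)
qed

lemma powr_le_endpoints:
  fixes x r R a :: real
  assumes "0 < r" "r \<le> x" "x \<le> R"
  shows "x powr a \<le> r powr a + R powr a"
proof (cases "a \<ge> 0")
  case True
  then have "x powr a \<le> R powr a" using assms by (intro powr_mono2) auto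
  then show ?thesis by (simp add: add_increasing)
next
  case False
  then have "x powr a \<le> r powr a" using assms by (intro powr_mono2') auto
  then show ?thesis by (simp add: add_increasing2)
qed

lemma norm_powr_integrable_near_0:
  assumes k: "real DIM('k::euclidean_space) + \<alpha> > 0" and R: "R > 0"
  shows "(\<integral>\<^sup>+y. ennreal (norm (y::'k) powr \<alpha>) * indicator {y. norm y \<le> R} y \<partial>lborel) < top"
proof -
  have "(\<integral>\<^sup>+y. ennreal (norm (y::'k) powr \<alpha>) * indicator {y. 0 < norm y \<and> norm y \<le> R} y \<partial>lborel) < top"
  proof (rule homogeneous_integrable_near_0[OF _ R _ k])
    have "(\<integral>\<^sup>+y. ennreal (norm (y::'k) powr \<alpha>) * indicator {y. R / 2 < norm y \<and> norm y \<le> R} y \<partial>lborel)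
      \<le> (\<integral>\<^sup>+y. ennreal ((R / 2) powr \<alpha> + R powr \<alpha>) * indicator (cball (0::'k) R) y \<partial>lborel)"
      using R by (intro nn_integral_mono)
       (auto simp: indicator_def intro!: powr_le_endpoints ennreal_leI simp del: ennreal_plus)
    also have "\<dots> < top"
      by (subst nn_integral_cmult_indicator)
        (auto simp: ennreal_mult_less_top emeasure_lborel_cball_finite[unfolded infinity_ennreal_def])
    finally show "(\<integral>\<^sup>+y. ennreal (norm (y::'k) powr \<alpha>) *
      indicator {y. R / 2 < norm y \<and> norm y \<le> R} y \<partial>lborel) < top" .
  qed (auto simp: powr_mult powr_divide powr_minus ennreal_mult' [symmetric] field_simps)
  also have "(\<integral>\<^sup>+y. ennreal (norm (y::'k) powr \<alpha>) * indicator {y. 0 < norm y \<and> norm y \<le> R} y \<partial>lborel) =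
     (\<integral>\<^sup>+y. ennreal (norm (y::'k) powr \<alpha>) * indicator {y. norm y \<le> R} y \<partial>lborel)"
    by (intro nn_integral_cong) (auto simp: indicator_def)
  finally show ?thesis .
qed

text \<open>
  On an annulus around the origin the factor \<open>|z|\<^sup>\<beta>\<close> is bounded above and below, so only the singularity
  of \<open>|y|\<^sup>\<alpha>\<close> along \<open>y = 0\<close> matters there; Tonelli reduces it to the first factor.
\<close>

lemma weight_integrable_near_0:
  assumes k: "real DIM('k::euclidean_space) + \<alpha> > 0"
    and d: "real DIM('k \<times> 'm::euclidean_space) + \<alpha> + \<beta> > 0" and R: "R > 0"
  shows "(\<integral>\<^sup>+z. ennreal (weight \<alpha> \<beta> (z::'k \<times> 'm)) *
      indicator {z. norm z \<le> R} z \<partial>lborel) < top"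
proof -
  let ?w = "\<lambda>z::'k \<times> 'm. ennreal (weight \<alpha> \<beta> z)"
  have "(\<integral>\<^sup>+z. ?w z * indicator {z. 0 < norm z \<and> norm z \<le> R} z \<partial>lborel) < top"
  proof (rule homogeneous_integrable_near_0[OF _ R])
    show "0 < real DIM('k \<times> 'm) + (\<alpha> + \<beta>)" using d by simp
    show "?w ((1/2) *\<^sub>R z) = ennreal (2 powr - (\<alpha> + \<beta>)) * ?w z" for z
    proof -
      have "weight \<alpha> \<beta> ((1/2) *\<^sub>R z) = 2 powr - (\<alpha> + \<beta>) * weight \<alpha> \<beta> z"
        by (subst weight_scaleR) (simp_all add: powr_divide powr_minus_divide del: minus_add_distrib)
      then show ?thesis by (simp add: ennreal_mult' del: minus_add_distrib)
    qed
    let ?C = "(R / 2) powr \<beta> + R powr \<beta>"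
    have "(\<integral>\<^sup>+z. ?w z * indicator {z. R / 2 < norm z \<and> norm z \<le> R} z \<partial>lborel)
      \<le> (\<integral>\<^sup>+z. ennreal ?C * ((ennreal (norm (fst z) powr \<alpha>) * indicator {y. norm y \<le> R} (fst z)) *
           indicator (cball 0 R) (snd (z::'k \<times> 'm))) \<partial>lborel)"
    proof (intro nn_integral_mono)
      fix z :: "'k \<times> 'm"
      show "?w z * indicator {z. R / 2 < norm z \<and> norm z \<le> R} z \<le>
        ennreal ?C * ((ennreal (norm (fst z) powr \<alpha>) * indicator {y. norm y \<le> R} (fst z)) *
           indicator (cball 0 R) (snd z))"
      proof (cases "R / 2 < norm z \<and> norm z \<le> R")
        case True
        then have "norm (fst z) \<le> R" "norm (snd z) \<le> R"
          using norm_fst_le[of "fst z" "snd z"] norm_snd_le[of "snd z" "fst z"] by auto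
        moreover have "weight \<alpha> \<beta> z \<le> ?C * norm (fst z) powr \<alpha>"
          using powr_le_endpoints[of "R/2" "norm z" R \<beta>] True R
          unfolding weight_def by (subst mult.commute) (auto intro: mult_right_mono)
        ultimately show ?thesis using True
          by (simp add: ennreal_mult'[symmetric] ennreal_leI del: ennreal_plus)
      qed auto
    qed
    also have "\<dots> = ennreal ?C * (\<integral>\<^sup>+z. ((ennreal (norm (fst (z::'k \<times> 'm)) powr \<alpha>) * indicator {y. norm y \<le> R} (fst z)) *
           indicator (cball 0 R) (snd z)) \<partial>(lborel \<Otimes>\<^sub>M lborel))"
    proof -
      have [measurable]: "cball (0::'m) R \<in> sets borel" by simp
      show ?thesis unfolding lborel_prod[symmetric] by (intro nn_integral_cmult) measurable
    qed
    also have "\<dots> = ennreal ?C * ((\<integral>\<^sup>+y. ennreal (norm (y::'k) powr \<alpha>) * indicator {y. norm y \<le> R} y \<partial>lborel) *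
       emeasure lborel (cball (0::'m) R))"
    proof -
      have [measurable]: "cball (0::'m) R \<in> sets borel" by simp
      show ?thesis
      proof (subst lborel.nn_integral_fst[symmetric])
        show "ennreal ?C * (\<integral>\<^sup>+y. \<integral>\<^sup>+x. (ennreal (norm (fst (y::'k, x)) powr \<alpha>) *
            indicator {y. norm y \<le> R} (fst (y, x))) * indicator (cball (0::'m) R) (snd (y, x)) \<partial>lborel \<partial>lborel) =
          ennreal ?C * ((\<integral>\<^sup>+y. ennreal (norm (y::'k) powr \<alpha>) * indicator {y. norm y \<le> R} y \<partial>lborel) *
            emeasure lborel (cball (0::'m) R))"
          unfolding fst_conv snd_conv
          by (subst nn_integral_cmult_indicator) (simp_all add: nn_integral_multc)
      qed measurable
    qed
    also have "\<dots> < top" using norm_powr_integrable_near_0[OF k R]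
      by (auto simp: ennreal_mult_less_top emeasure_lborel_cball_finite[unfolded infinity_ennreal_def])
    finally show "(\<integral>\<^sup>+z. ?w z * indicator {z. R / 2 < norm z \<and> norm z \<le> R} z \<partial>lborel) < top" .
  qed measurable
  also have "(\<integral>\<^sup>+z. ?w z * indicator {z. 0 < norm z \<and> norm z \<le> R} z \<partial>lborel) =
     (\<integral>\<^sup>+z. ?w z * indicator {z. norm z \<le> R} z \<partial>lborel)"
    by (intro nn_integral_cong) (auto simp: indicator_def weight_eq_0_iff)
  finally show ?thesis .
qed

lemma weighted_integral_bounded_support_finite:
  fixes f :: "'k::euclidean_space \<times> 'm::euclidean_space \<Rightarrow> 'v::real_normed_vector"
  assumes k: "real DIM('k) + \<alpha> > 0" and d: "real DIM('k \<times> 'm) + \<alpha> + \<beta> > 0" and R: "R > 0" and p: "p > 0"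
    and C: "\<And>z. norm (f z) \<le> C" and supp: "\<And>z. norm z > R \<Longrightarrow> f z = 0"
  shows "weighted_integral \<alpha> \<beta> p f < top"
proof -
  let ?w = "\<lambda>z::'k \<times> 'm. weight \<alpha> \<beta> z"
  have "weighted_integral \<alpha> \<beta> p f \<le>
     (\<integral>\<^sup>+z. ennreal (C powr p) * (ennreal (?w z) * indicator {z. norm z \<le> R} z) \<partial>lborel)"
    unfolding weighted_integral_weight
  proof (intro nn_integral_mono)
    fix z :: "'k \<times> 'm"
    have "norm (f z) powr p \<le> C powr p" using C p by (intro powr_mono2) auto
    then have "?w z * norm (f z) powr p \<le> C powr p * ?w z"
      by (subst mult.commute[of "C powr p"]) (intro mult_left_mono, auto)
    then show "ennreal (?w z * norm (f z) powr p) \<le>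
        ennreal (C powr p) * (ennreal (?w z) * indicator {z. norm z \<le> R} z)"
      using supp[of z] by (cases "norm z \<le> R") (auto simp: ennreal_mult'[symmetric] ennreal_leI)
  qed
  also have "\<dots> < top" using weight_integrable_near_0[OF k d R]
    by (subst nn_integral_cmult) (auto simp: ennreal_mult_less_top)
  finally show ?thesis .
qed

section \<open>Convergence in weighted norms\<close>

lemma weighted_integral_add_le:
  fixes f g :: "'k::euclidean_space \<times> 'm::euclidean_space \<Rightarrow> 'v::euclidean_space"
  assumes [measurable]: "f \<in> borel_measurable borel" "g \<in> borel_measurable borel"
    and p: "p > 1" and \<theta>: "0 < \<theta>" "\<theta> < 1"
  shows "weighted_integral \<alpha> \<beta> p (\<lambda>z. f z + g z) \<le>
     ennreal ((1 - \<theta>) powr (1 - p)) * weighted_integral \<alpha> \<beta> p f +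
     ennreal (\<theta> powr (1 - p)) * weighted_integral \<alpha> \<beta> p g"
proof -
  let ?w = "\<lambda>z::'k \<times> 'm. weight \<alpha> \<beta> z"
  have "weighted_integral \<alpha> \<beta> p (\<lambda>z. f z + g z) \<le>
    (\<integral>\<^sup>+z. ennreal ((1 - \<theta>) powr (1 - p)) * ennreal (?w z * norm (f z) powr p) +
       ennreal (\<theta> powr (1 - p)) * ennreal (?w z * norm (g z) powr p) \<partial>lborel)"
    unfolding weighted_integral_weight
  proof (intro nn_integral_mono)
    fix z :: "'k \<times> 'm"
    have "?w z * norm (f z + g z) powr p \<le>
      ?w z * ((1 - \<theta>) powr (1 - p) * norm (f z) powr p + \<theta> powr (1 - p) * norm (g z) powr p)"
      using norm_add_powr_le[OF p \<theta>] by (intro mult_left_mono) auto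
    then show "ennreal (?w z * norm (f z + g z) powr p) \<le>
       ennreal ((1 - \<theta>) powr (1 - p)) * ennreal (?w z * norm (f z) powr p) +
       ennreal (\<theta> powr (1 - p)) * ennreal (?w z * norm (g z) powr p)"
      by (simp add: ennreal_mult'[symmetric] ennreal_plus[symmetric] ennreal_leI algebra_simps
          del: ennreal_plus)
  qed
  also have "\<dots> = ennreal ((1 - \<theta>) powr (1 - p)) * weighted_integral \<alpha> \<beta> p f +
     ennreal (\<theta> powr (1 - p)) * weighted_integral \<alpha> \<beta> p g"
    unfolding weighted_integral_weight by (subst nn_integral_add) (auto simp: nn_integral_cmult)
  finally show ?thesis .
qed

lemma AE_fst_nonzero: "AE z::'k::euclidean_space \<times> 'm::euclidean_space in lborel. fst z \<noteq> 0"
proof -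
  have "AE y::'k in lborel. AE x::'m in lborel. fst (y, x) \<noteq> 0"
    using AE_lborel_singleton[of "0::'k"] by (rule eventually_mono) auto
  then have "AE z::'k \<times> 'm in lborel \<Otimes>\<^sub>M lborel. fst z \<noteq> 0"
    by (rule lborel_pair.AE_pair_measure[rotated]) measurable
  then show ?thesis unfolding lborel_prod .
qed

lemma suminf_ennreal_finite_imp_tendsto_0:
  fixes f :: "nat \<Rightarrow> ennreal"
  assumes "(\<Sum>n. f n) < top"
  shows "f \<longlonglongrightarrow> 0"
proof -
  have nt: "f n \<noteq> top" for n
    using assms sum_le_suminf[of f "{n}"] by (auto simp: top_unique)
  have "summable (\<lambda>n. enn2real (f n))"
    using assms nt by (intro summable_suminf_not_top) (simp_all add: ennreal_enn2real less_top[symmetric])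
  then have "(\<lambda>n. enn2real (f n)) \<longlonglongrightarrow> 0" by (rule summable_LIMSEQ_zero)
  then have "(\<lambda>n. ennreal (enn2real (f n))) \<longlonglongrightarrow> ennreal 0" by (rule tendsto_ennrealI)
  then show ?thesis using nt by (simp add: ennreal_enn2real less_top)
qed

lemma tendsto_0_if_powr_tendsto_0:
  fixes f :: "'i \<Rightarrow> 'v::real_normed_vector"
  assumes "((\<lambda>n. norm (f n) powr p) \<longlongrightarrow> 0) F" "p > 0"
  shows "(f \<longlongrightarrow> 0) F"
proof -
  have "((\<lambda>n. (norm (f n) powr p) powr (1 / p)) \<longlongrightarrow> 0 powr (1 / p)) F"
    using assms by (intro tendsto_powr' tendsto_const) auto
  then have "((\<lambda>n. norm (f n)) \<longlongrightarrow> 0) F" using assms by (simp add: powr_powr)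
  then show ?thesis by (rule tendsto_norm_zero_cancel)
qed

text \<open>
  Summability of the norms makes the pointwise series of \<open>p\<close>-th powers finite almost everywhere, so
  no further passage to a subsequence is needed.
\<close>

lemma weighted_integral_summable_imp_AE_tendsto_0:
  fixes f :: "nat \<Rightarrow> 'k::euclidean_space \<times> 'm::euclidean_space \<Rightarrow> 'v::euclidean_space"
  assumes [measurable]: "\<And>n. f n \<in> borel_measurable borel"
    and p: "p > 0" and fin: "(\<Sum>n. weighted_integral \<alpha> \<beta> p (f n)) < top"
  shows "AE z in lborel. (\<lambda>n. f n z) \<longlonglongrightarrow> 0"
proof -
  let ?w = "\<lambda>z::'k \<times> 'm. weight \<alpha> \<beta> z"
  have "(\<integral>\<^sup>+z. (\<Sum>n. ennreal (?w z * norm (f n z) powr p)) \<partial>lborel) < top"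
    using fin unfolding weighted_integral_weight by (subst nn_integral_suminf) auto
  then have "AE z in lborel. (\<Sum>n. ennreal (?w z * norm (f n z) powr p)) \<noteq> \<infinity>"
    by (intro nn_integral_PInf_AE) auto
  then show ?thesis using AE_fst_nonzero
  proof eventually_elim
    case (elim z)
    then have "(\<lambda>n. ennreal (?w z * norm (f n z) powr p)) \<longlonglongrightarrow> ennreal 0"
      using suminf_ennreal_finite_imp_tendsto_0[of "\<lambda>n. ennreal (?w z * norm (f n z) powr p)"]
      by (simp add: less_top)
    then have "(\<lambda>n. ?w z * norm (f n z) powr p) \<longlonglongrightarrow> 0"
      by (subst (asm) tendsto_ennreal_iff) auto
    moreover have w: "?w z \<noteq> 0" using elim by (simp add: weight_eq_0_iff)
    ultimately have "(\<lambda>n. (1 / ?w z) * (?w z * norm (f n z) powr p)) \<longlonglongrightarrow> (1 / ?w z) * 0"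
      by (intro tendsto_mult_left)
    then have "(\<lambda>n. norm (f n z) powr p) \<longlonglongrightarrow> 0" using w by simp
    then show ?case using p by (rule tendsto_0_if_powr_tendsto_0)
  qed
qed

text \<open>
  Geometric rates are arranged by passing to a subsequence; they give almost everywhere convergence of
  functions and gradients simultaneously.
\<close>

lemma D1p_fast_approximation:
  assumes "(u, G) \<in> D1p p a b"
  obtains \<phi> where "\<And>n. \<phi> n \<in> Cc_infinity"
    "\<And>n. weighted_integral a (- b) p (\<lambda>z. gradient (\<phi> n) z - G z) \<le> ennreal ((1/2) ^ n)"
    "\<And>n. weighted_integral a (- b - p) p (\<lambda>z. \<phi> n z - u z) \<le> ennreal ((1/2) ^ n)"
proof -
  obtain \<psi> where \<psi>: "\<And>n. \<psi> n \<in> Cc_infinity"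
    "(\<lambda>n. weighted_integral a (- b) p (\<lambda>z. gradient (\<psi> n) z - G z)) \<longlonglongrightarrow> 0"
    "(\<lambda>n. weighted_integral a (- b - p) p (\<lambda>z. \<psi> n z - u z)) \<longlonglongrightarrow> 0"
    using assms by (auto simp: D1p_def)
  define P where "P n m \<longleftrightarrow> weighted_integral a (- b) p (\<lambda>z. gradient (\<psi> m) z - G z) < ennreal ((1/2) ^ n) \<and>
     weighted_integral a (- b - p) p (\<lambda>z. \<psi> m z - u z) < ennreal ((1/2) ^ n)" for n m
  have "\<exists>m. P n m" for n
  proof -
    have "(0::ennreal) < ennreal ((1/2) ^ n)" by simp
    from eventually_conj[OF order_tendstoD(2)[OF \<psi>(2) this] order_tendstoD(2)[OF \<psi>(3) this]]
    have "eventually (P n) sequentially" unfolding P_def .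
    then show ?thesis by (rule eventually_happens'[OF sequentially_bot])
  qed
  then obtain m where m: "\<And>n. P n (m n)" by metis
  show thesis
    by (rule that[OF \<psi>(1) less_imp_le less_imp_le, of m]) (use m in \<open>auto simp: P_def\<close>)
qed

lemma suminf_le_geometric_finite:
  fixes f :: "nat \<Rightarrow> ennreal"
  assumes "\<And>n. f n \<le> ennreal ((1/2) ^ n)"
  shows "(\<Sum>n. f n) < top"
proof -
  have "(\<Sum>n. f n) \<le> (\<Sum>n. ennreal ((1/2) ^ n))" using assms by (rule suminf_le[OF _ summableI summableI])
  also have "\<dots> = ennreal (\<Sum>n. (1/2) ^ n)"
    by (intro suminf_ennreal2) (auto simp: summable_geometric)
  finally show ?thesis by (auto intro: le_less_trans)
qed

lemma suminf_le_cmult_geometric_finite: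
  fixes f :: "nat \<Rightarrow> ennreal"
  assumes "\<And>n. f n \<le> K * ennreal ((1/2) ^ n)" and "K < top"
  shows "(\<Sum>n. f n) < top"
proof -
  have "(\<Sum>n. f n) \<le> (\<Sum>n. K * ennreal ((1/2) ^ n))" using assms
    by (intro suminf_le summableI) auto
  also have "\<dots> = K * (\<Sum>n. ennreal ((1/2) ^ n))" by simp
  also have "\<dots> < top"
    by (intro ennreal_mult_less_top[THEN iffD2] disjI2 conjI assms(2) suminf_le_geometric_finite order_refl)
  finally show ?thesis .
qed

lemma weighted_integral_minus_commute:
  "weighted_integral \<alpha> \<beta> p (\<lambda>z. f z - g z) = weighted_integral \<alpha> \<beta> p (\<lambda>z. g z - f z)"
  by (simp add: weighted_integral_def norm_minus_commute)

lemma weighted_integral_limit_finite: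
  fixes f g :: "'k::euclidean_space \<times> 'm::euclidean_space \<Rightarrow> 'v::euclidean_space"
  assumes [measurable]: "f \<in> borel_measurable borel" "g \<in> borel_measurable borel"
    and p: "p > 1" and f: "weighted_integral \<alpha> \<beta> p f < top"
    and fg: "weighted_integral \<alpha> \<beta> p (\<lambda>z. f z - g z) < top"
  shows "weighted_integral \<alpha> \<beta> p g < top"
proof -
  have "weighted_integral \<alpha> \<beta> p (\<lambda>z. f z + (g z - f z)) \<le>
     ennreal ((1 - 1/2) powr (1 - p)) * weighted_integral \<alpha> \<beta> p f +
     ennreal ((1/2) powr (1 - p)) * weighted_integral \<alpha> \<beta> p (\<lambda>z. g z - f z)"
    by (rule weighted_integral_add_le) (use p in auto)
  also have "\<dots> < top"
    using f fg weighted_integral_minus_commute[of \<alpha> \<beta> p f g] by (auto simp: ennreal_mult_less_top)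
  finally show ?thesis by simp
qed

text \<open>
  The quasi-triangle inequality with parameter \<open>\<theta>\<close> bounds the limit inferior by
  \<open>(1 - \<theta>)\<^sup>1\<^sup>-\<^sup>p\<close> times the right-hand side, and \<open>\<theta> \<rightarrow> 0\<close> removes the factor.
\<close>

lemma weighted_integral_liminf_le:
  fixes g :: "'k::euclidean_space \<times> 'm::euclidean_space \<Rightarrow> 'v::euclidean_space"
  assumes [measurable]: "\<And>n. f n \<in> borel_measurable borel" "g \<in> borel_measurable borel"
    and p: "p > 1" and g: "weighted_integral \<alpha> \<beta> p g < top"
    and fg: "\<And>n. weighted_integral \<alpha> \<beta> p (\<lambda>z. f n z - g z) \<le> ennreal ((1/2) ^ n)"
  shows "liminf (\<lambda>n. weighted_integral \<alpha> \<beta> p (f n)) \<le> weighted_integral \<alpha> \<beta> p g"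
proof -
  obtain I where I: "weighted_integral \<alpha> \<beta> p g = ennreal I" "I \<ge> 0"
    using g by (cases "weighted_integral \<alpha> \<beta> p g") auto
  let ?L = "liminf (\<lambda>n. weighted_integral \<alpha> \<beta> p (f n))"
  have "?L \<le> ennreal ((1 - \<theta>) powr (1 - p) * I)" if \<theta>: "0 < \<theta>" "\<theta> < 1" for \<theta>
  proof -
    have "weighted_integral \<alpha> \<beta> p (f n) \<le> ennreal ((1 - \<theta>) powr (1 - p) * I + \<theta> powr (1 - p) * (1/2) ^ n)" for n
    proof -
      have "weighted_integral \<alpha> \<beta> p (\<lambda>z. g z + (f n z - g z)) \<le>
         ennreal ((1 - \<theta>) powr (1 - p)) * weighted_integral \<alpha> \<beta> p g +
         ennreal (\<theta> powr (1 - p)) * weighted_integral \<alpha> \<beta> p (\<lambda>z. f n z - g z)"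
        by (rule weighted_integral_add_le) (use p \<theta> in auto)
      also have "\<dots> \<le> ennreal ((1 - \<theta>) powr (1 - p)) * ennreal I +
          ennreal (\<theta> powr (1 - p)) * ennreal ((1/2) ^ n)"
        unfolding I(1) by (intro add_mono mult_left_mono fg) auto
      finally show ?thesis using I by (simp add: ennreal_mult)
    qed
    then have "?L \<le> liminf (\<lambda>n. ennreal ((1 - \<theta>) powr (1 - p) * I + \<theta> powr (1 - p) * (1/2) ^ n))"
      by (intro Liminf_mono) auto
    also have "\<dots> = ennreal ((1 - \<theta>) powr (1 - p) * I + \<theta> powr (1 - p) * 0)"
      by (intro lim_imp_Liminf tendsto_ennrealI tendsto_intros LIMSEQ_power_zero) auto
    finally show ?thesis by simp
  qed
  then have "eventually (\<lambda>\<theta>. ?L \<le> ennreal ((1 - \<theta>) powr (1 - p) * I)) (at_right 0)"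
    unfolding eventually_at_right_field by (intro exI[of _ 1]) auto
  moreover have "((\<lambda>\<theta>. ennreal ((1 - \<theta>) powr (1 - p) * I)) \<longlongrightarrow> ennreal ((1 - 0) powr (1 - p) * I)) (at_right 0)"
    by (intro tendsto_ennrealI tendsto_intros) auto
  ultimately have "?L \<le> ennreal ((1 - 0) powr (1 - p) * I)"
    by (intro tendsto_lowerbound[where F = "at_right (0::real)"]) auto
  then show ?thesis by (simp add: I)
qed

text \<open>
  Both integrals are finite for test functions, by local integrability of the weights, and the
  approximation changes them by a finite amount.
\<close>

lemma D1p_finite:
  fixes u :: "'k::euclidean_space \<times> 'm::euclidean_space \<Rightarrow> real"
  assumes p: "p > 1" and k: "real DIM('k) + a > 0" and d: "real DIM('k \<times> 'm) + a - p > b"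
    and uG: "(u, G) \<in> D1p p a b"
  shows "weighted_integral a (- b) p G < top" and "weighted_integral a (- b - p) p u < top"
proof -
  have [measurable]: "u \<in> borel_measurable borel" "G \<in> borel_measurable borel"
    using uG by (auto simp: D1p_def)
  obtain \<phi> where \<phi>: "\<And>n::nat. \<phi> n \<in> Cc_infinity"
    and \<phi>G: "\<And>n. weighted_integral a (- b) p (\<lambda>z. gradient (\<phi> n) z - G z) \<le> ennreal ((1/2) ^ n)"
    and \<phi>u: "\<And>n. weighted_integral a (- b - p) p (\<lambda>z. \<phi> n z - u z) \<le> ennreal ((1/2) ^ n)"
    using D1p_fast_approximation[OF uG] by blast
  have [measurable]: "\<phi> 0 \<in> borel_measurable borel" "gradient (\<phi> 0) \<in> borel_measurable borel"
    by (auto intro!: borel_measurable_continuous_onI Cc_infinity_continuous continuous_on_gradient \<phi>)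
  obtain R C where R: "R > 0" "\<And>z. norm z > R \<Longrightarrow> \<phi> 0 z = 0" "\<And>z. \<bar>\<phi> 0 z\<bar> \<le> C"
    "\<And>z. norm z > R \<Longrightarrow> gradient (\<phi> 0) z = 0" "\<And>z. norm (gradient (\<phi> 0) z) \<le> C"
    using Cc_infinity_bounded_support[OF \<phi>[of 0]] by metis
  show "weighted_integral a (- b) p G < top"
  proof (rule weighted_integral_limit_finite[of "gradient (\<phi> 0)" G, OF _ _ p])
    show "weighted_integral a (- b) p (gradient (\<phi> 0)) < top"
      using k d p R by (intro weighted_integral_bounded_support_finite[of a _ R p _ C]) auto
    show "weighted_integral a (- b) p (\<lambda>z. gradient (\<phi> 0) z - G z) < top"
      using \<phi>G[of 0] by (rule le_less_trans) auto
  qed auto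
  show "weighted_integral a (- b - p) p u < top"
  proof (rule weighted_integral_limit_finite[of "\<phi> 0" u, OF _ _ p])
    show "weighted_integral a (- b - p) p (\<phi> 0) < top"
      using k d p R by (intro weighted_integral_bounded_support_finite[of a _ R p _ C]) auto
    show "weighted_integral a (- b - p) p (\<lambda>z. \<phi> 0 z - u z) < top"
      using \<phi>u[of 0] by (rule le_less_trans) auto
  qed auto
qed

section \<open>Minimisers are proportional to their dilations\<close>

lemma best_constant_le:
  fixes \<phi> :: "'k::euclidean_space \<times> 'm::euclidean_space \<Rightarrow> real"
  assumes "\<phi> \<in> Cc_infinity"
  shows "best_constant TYPE('k \<times> 'm) p a b \<gamma> * weighted_integral (a - p - b + \<gamma>) (- \<gamma>) p \<phi>
    \<le> weighted_integral a (- b) p (gradient \<phi>)"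
proof -
  let ?A = "{S. \<forall>\<phi>\<in>(Cc_infinity :: ('k \<times> 'm \<Rightarrow> real) set).
       S * weighted_integral (a - p - b + \<gamma>) (- \<gamma>) p \<phi> \<le> weighted_integral a (- b) p (gradient \<phi>)}"
  have "(SUP S\<in>?A. S) * weighted_integral (a - p - b + \<gamma>) (- \<gamma>) p \<phi> =
    (SUP S\<in>?A. S * weighted_integral (a - p - b + \<gamma>) (- \<gamma>) p \<phi>)"
    by (rule SUP_mult_right_ennreal)
  also have "\<dots> \<le> weighted_integral a (- b) p (gradient \<phi>)"
    using assms by (intro SUP_least) auto
  finally show ?thesis by (simp add: best_constant_def)
qed

text \<open>
  Let \<open>U\<^sub>n\<close> be the regularised mean of \<open>\<phi>\<^sub>n\<close> and its dilate, and \<open>D\<^sub>n \<ge> 0\<close> the deficit in the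
  convexity inequality. The inequality with best constant \<open>\<sigma>\<close>, applied to \<open>U\<^sub>n\<close>, reads
  \<open>\<sigma> \<integral> v U\<^sub>n\<^sup>p + \<integral> w D\<^sub>n \<le> \<integral> w |\<nabla>\<phi>\<^sub>n|\<^sup>p\<close>, because a function and its dilate have the same energy.
  In the limit the first term becomes \<open>\<sigma> \<integral> v |u|\<^sup>p\<close>, which equals \<open>\<integral> w |G|\<^sup>p\<close> by the assumption on
  \<open>u\<close>. This leaves nothing for the limit of the deficits, and deficit zero means proportionality.
\<close>

lemma minimiser_gradient_proportional_dilate:
  fixes u :: "'k::euclidean_space \<times> 'm::euclidean_space \<Rightarrow> real" and p a b \<gamma> s H :: real
  assumes p: "p > 1" and k: "real DIM('k) + a > 0"
    and H: "H * p = real DIM('k \<times> 'm) + a - b - p" and d: "real DIM('k \<times> 'm) + a - p > b"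
    and uG: "(u, G) \<in> D1p p a b"
    and fin: "best_constant TYPE('k \<times> 'm) p a b \<gamma> < top"
    and eq: "weighted_integral a (- b) p G =
       best_constant TYPE('k \<times> 'm) p a b \<gamma> * weighted_integral (a - p - b + \<gamma>) (- \<gamma>) p u"
  shows "AE z in lborel. dilate H s u z *\<^sub>R G z = u z *\<^sub>R dilate (H + 1) s G z"
proof -
  have [measurable]: "u \<in> borel_measurable borel" "G \<in> borel_measurable borel"
    using uG by (auto simp: D1p_def)
  obtain \<phi> where \<phi>: "\<And>n. \<phi> n \<in> Cc_infinity"
    and \<phi>G: "\<And>n. weighted_integral a (- b) p (\<lambda>z. gradient (\<phi> n) z - G z) \<le> ennreal ((1/2) ^ n)"
    and \<phi>u: "\<And>n. weighted_integral a (- b - p) p (\<lambda>z. \<phi> n z - u z) \<le> ennreal ((1/2) ^ n)"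
    using D1p_fast_approximation[OF uG] by blast
  have [measurable]: "\<phi> n \<in> borel_measurable borel" "gradient (\<phi> n) \<in> borel_measurable borel" for n
    by (auto intro!: borel_measurable_continuous_onI Cc_infinity_continuous continuous_on_gradient \<phi>)
  define \<epsilon> :: "nat \<Rightarrow> real" where "\<epsilon> n = (1/2) ^ n" for n
  have \<epsilon>: "\<epsilon> n > 0" for n by (simp add: \<epsilon>_def)
  have \<epsilon>0: "\<epsilon> \<longlonglongrightarrow> 0" unfolding \<epsilon>_def[abs_def] by (rule LIMSEQ_power_zero) simp
  define w :: "'k \<times> 'm \<Rightarrow> real" where "w = weight a (- b)"
  define v :: "'k \<times> 'm \<Rightarrow> real" where "v = weight (a - p - b + \<gamma>) (- \<gamma>)"
  have [measurable]: "w \<in> borel_measurable borel" "v \<in> borel_measurable borel"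
    by (auto simp: w_def v_def)
  have w0: "w z \<ge> 0" and v0: "v z \<ge> 0" for z by (auto simp: w_def v_def)
  define X where "X n = gradient (\<phi> n)" for n
  define Y where "Y n = dilate (H + 1) s (X n)" for n
  define g where "g n = dilate H s (\<phi> n)" for n
  have [measurable]: "X n \<in> borel_measurable borel" "Y n \<in> borel_measurable borel"
    "g n \<in> borel_measurable borel" for n
    by (auto simp: X_def Y_def g_def)
  define Y0 where "Y0 = dilate (H + 1) s G"
  define g0 where "g0 = dilate H s u"
  have [measurable]: "Y0 \<in> borel_measurable borel" "g0 \<in> borel_measurable borel"
    by (auto simp: Y0_def g0_def)
  have g: "g n \<in> Cc_infinity" and Y: "Y n = gradient (g n)" for n
    by (auto simp: g_def Y_def X_def \<phi> dilate_Cc_infinity gradient_dilate)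
  define U where "U n z = power_mean p (\<epsilon> n) (\<phi> n z) (g n z) - \<epsilon> n" for n z
  define V where "V n z = mean_gradient p (\<epsilon> n) (\<phi> n z) (g n z) (X n z) (Y n z)" for n z
  define U0 where "U0 z = power_mean p 0 (u z) (g0 z)" for z
  define V0 where "V0 z = mean_gradient p 0 (u z) (g0 z) (G z) (Y0 z)" for z
  have [measurable]: "U n \<in> borel_measurable borel" "V n \<in> borel_measurable borel" for n
    unfolding U_def[abs_def] V_def[abs_def] by measurable
  have [measurable]: "U0 \<in> borel_measurable borel" "V0 \<in> borel_measurable borel"
    unfolding U0_def[abs_def] V0_def[abs_def] by measurable
  have U: "U n \<in> Cc_infinity" and gradU: "gradient (U n) = V n" for n
    using power_mean_Cc_infinity[OF p \<epsilon> \<phi> g, of n n n] unfolding U_def[abs_def] V_def[abs_def] X_def Y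
    by auto
  define D where "D n z = (norm (X n z) powr p + norm (Y n z) powr p) / 2 - norm (V n z) powr p" for n z
  \<comment> \<open>Where both functions vanish the gradients of the means need not converge, but there the claim is
    trivial, and \<open>0\<close> is a lower bound for the deficits.\<close>
  define D0 where "D0 z = (if u z = 0 \<and> g0 z = 0 then 0
     else (norm (G z) powr p + norm (Y0 z) powr p) / 2 - norm (V0 z) powr p)" for z
  have [measurable]: "D n \<in> borel_measurable borel" "D0 \<in> borel_measurable borel" for n
    unfolding D_def[abs_def] D0_def[abs_def] by measurable
  have D_nonneg: "D n z \<ge> 0" for n z
    using norm_mean_gradient_le[OF p \<epsilon>] by (simp add: D_def V_def)
  have D0_nonneg: "D0 z \<ge> 0" for z
    using norm_mean_gradient_0_le[OF p] by (auto simp: D0_def V0_def)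
  have [simp]: "weighted_integral a (- b) p (Y n) = weighted_integral a (- b) p (X n)" for n
    unfolding Y_def by (intro weighted_integral_dilate) (use H in \<open>auto simp: algebra_simps\<close>)
  have [simp]: "weighted_integral (a - p - b + \<gamma>) (- \<gamma>) p g0 = weighted_integral (a - p - b + \<gamma>) (- \<gamma>) p u"
    unfolding g0_def by (intro weighted_integral_dilate) (use H in \<open>auto simp: algebra_simps\<close>)
  have average: "(\<integral>\<^sup>+z. ennreal (weight \<alpha> \<beta> z * ((norm (f z) powr p + norm (h z) powr p) / 2)) \<partial>lborel) =
       weighted_integral \<alpha> \<beta> p f"
    if [measurable]: "f \<in> borel_measurable borel" "h \<in> borel_measurable borel"
      and e: "weighted_integral \<alpha> \<beta> p h = weighted_integral \<alpha> \<beta> p f"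
    for \<alpha> \<beta> and f h :: "'k \<times> 'm \<Rightarrow> 'v::euclidean_space"
  proof -
    have "(\<integral>\<^sup>+z. ennreal (weight \<alpha> \<beta> z * ((norm (f z) powr p + norm (h z) powr p) / 2)) \<partial>lborel) =
      (\<integral>\<^sup>+z. ennreal (1/2) * ennreal (weight \<alpha> \<beta> z * norm (f z) powr p) +
         ennreal (1/2) * ennreal (weight \<alpha> \<beta> z * norm (h z) powr p) \<partial>lborel)"
    proof (intro nn_integral_cong)
      fix z :: "'k \<times> 'm"
      let ?x = "weight \<alpha> \<beta> z * norm (f z) powr p" and ?y = "weight \<alpha> \<beta> z * norm (h z) powr p"
      have "ennreal (weight \<alpha> \<beta> z * ((norm (f z) powr p + norm (h z) powr p) / 2)) =
          ennreal (1/2 * ?x + 1/2 * ?y)" by (simp add: field_simps)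
      also have "\<dots> = ennreal (1/2 * ?x) + ennreal (1/2 * ?y)" by (rule ennreal_plus) auto
      also have "\<dots> = ennreal (1/2) * ennreal ?x + ennreal (1/2) * ennreal ?y"
        by (intro arg_cong2[where f = "(+)"] ennreal_mult) auto
      finally show "ennreal (weight \<alpha> \<beta> z * ((norm (f z) powr p + norm (h z) powr p) / 2)) =
          ennreal (1/2) * ennreal ?x + ennreal (1/2) * ennreal ?y" .
    qed
    also have "\<dots> = ennreal (1/2) * weighted_integral \<alpha> \<beta> p f + ennreal (1/2) * weighted_integral \<alpha> \<beta> p f"
      by (simp add: nn_integral_add nn_integral_cmult e flip: weighted_integral_weight)
    also have "\<dots> = ennreal (1/2 + 1/2) * weighted_integral \<alpha> \<beta> p f"
      by (subst ennreal_plus) (auto simp: distrib_right)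
    finally show ?thesis by simp
  qed
  obtain \<sigma> where \<sigma>: "best_constant TYPE('k \<times> 'm) p a b \<gamma> = ennreal \<sigma>" "\<sigma> \<ge> 0"
    using fin by (cases "best_constant TYPE('k \<times> 'm) p a b \<gamma>") auto
  have split: "(\<integral>\<^sup>+z. ennreal (\<sigma> * (v z * \<bar>h z\<bar> powr p) + w z * E z) \<partial>lborel) =
     ennreal \<sigma> * weighted_integral (a - p - b + \<gamma>) (- \<gamma>) p h + (\<integral>\<^sup>+z. ennreal (w z * E z) \<partial>lborel)"
    if [measurable]: "h \<in> borel_measurable borel" "E \<in> borel_measurable borel" and "\<And>z. E z \<ge> 0"
    for h E :: "'k \<times> 'm \<Rightarrow> real"
  proof -
    have "(\<integral>\<^sup>+z. ennreal (\<sigma> * (v z * \<bar>h z\<bar> powr p) + w z * E z) \<partial>lborel) =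
      (\<integral>\<^sup>+z. ennreal \<sigma> * ennreal (v z * \<bar>h z\<bar> powr p) + ennreal (w z * E z) \<partial>lborel)"
      using that \<sigma> w0 v0 by (intro nn_integral_cong) (simp add: ennreal_mult)
    then show ?thesis
      by (simp add: nn_integral_add nn_integral_cmult weighted_integral_weight v_def)
  qed
  define F where "F n z = ennreal (\<sigma> * (v z * \<bar>U n z\<bar> powr p) + w z * D n z)" for n z
  have [measurable]: "F n \<in> borel_measurable borel" for n unfolding F_def[abs_def] by measurable
  have "(\<integral>\<^sup>+z. F n z \<partial>lborel) \<le> weighted_integral a (- b) p (X n)" for n
  proof -
    have "(\<integral>\<^sup>+z. F n z \<partial>lborel) =
       ennreal \<sigma> * weighted_integral (a - p - b + \<gamma>) (- \<gamma>) p (U n) + (\<integral>\<^sup>+z. ennreal (w z * D n z) \<partial>lborel)"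
      unfolding F_def by (intro split D_nonneg) auto
    also have "\<dots> \<le> weighted_integral a (- b) p (V n) + (\<integral>\<^sup>+z. ennreal (w z * D n z) \<partial>lborel)"
      using best_constant_le[OF U, of p a b \<gamma> n] unfolding \<sigma> gradU by (intro add_right_mono)
    also have "\<dots> = (\<integral>\<^sup>+z. ennreal (w z * norm (V n z) powr p) + ennreal (w z * D n z) \<partial>lborel)"
      by (subst nn_integral_add) (auto simp: weighted_integral_weight w_def)
    also have "\<dots> = (\<integral>\<^sup>+z. ennreal (w z * ((norm (X n z) powr p + norm (Y n z) powr p) / 2)) \<partial>lborel)"
    proof (intro nn_integral_cong)
      fix z
      have "ennreal (w z * norm (V n z) powr p) + ennreal (w z * D n z) =
          ennreal (w z * norm (V n z) powr p + w z * D n z)"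
        using w0 D_nonneg by (intro ennreal_plus[symmetric]) auto
      also have "w z * norm (V n z) powr p + w z * D n z =
          w z * ((norm (X n z) powr p + norm (Y n z) powr p) / 2)"
        by (simp add: D_def algebra_simps)
      finally show "ennreal (w z * norm (V n z) powr p) + ennreal (w z * D n z) =
          ennreal (w z * ((norm (X n z) powr p + norm (Y n z) powr p) / 2))" .
    qed
    also have "\<dots> = weighted_integral a (- b) p (X n)" unfolding w_def by (intro average) auto
    finally show ?thesis .
  qed
  then have "liminf (\<lambda>n. \<integral>\<^sup>+z. F n z \<partial>lborel) \<le> liminf (\<lambda>n. weighted_integral a (- b) p (X n))"
    by (intro Liminf_mono) auto
  also have I: "weighted_integral a (- b) p G < top" by (rule D1p_finite(1)[OF p k d uG])
  have "liminf (\<lambda>n. weighted_integral a (- b) p (X n)) \<le> weighted_integral a (- b) p G"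
    using \<phi>G by (intro weighted_integral_liminf_le p I) (auto simp: X_def)
  finally have "liminf (\<lambda>n. \<integral>\<^sup>+z. F n z \<partial>lborel) \<le> weighted_integral a (- b) p G" .
  then have Fatou: "(\<integral>\<^sup>+z. liminf (\<lambda>n. F n z) \<partial>lborel) \<le> weighted_integral a (- b) p G"
    by (intro order_trans[OF nn_integral_liminf]) auto
  have lim_u: "AE z in lborel. (\<lambda>n. \<phi> n z) \<longlonglongrightarrow> u z"
  proof -
    have "AE z in lborel. (\<lambda>n. \<phi> n z - u z) \<longlonglongrightarrow> 0"
      by (rule weighted_integral_summable_imp_AE_tendsto_0[OF _ _ suminf_le_geometric_finite[OF \<phi>u]])
        (use p in auto)
    then show ?thesis by (simp add: LIM_zero_iff)
  qed
  have lim_G: "AE z in lborel. (\<lambda>n. X n z) \<longlonglongrightarrow> G z"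
  proof -
    have "AE z in lborel. (\<lambda>n. X n z - G z) \<longlonglongrightarrow> 0" unfolding X_def
      by (rule weighted_integral_summable_imp_AE_tendsto_0[OF _ _ suminf_le_geometric_finite[OF \<phi>G]])
        (use p in auto)
    then show ?thesis by (simp add: LIM_zero_iff)
  qed
  have "AE z in lborel. ennreal (\<sigma> * (v z * \<bar>U0 z\<bar> powr p) + w z * D0 z) \<le> liminf (\<lambda>n. F n z)"
    using lim_u lim_G AE_lborel_scaleR[OF lim_u exp_gt_zero[of s]] AE_lborel_scaleR[OF lim_G exp_gt_zero[of s]]
  proof eventually_elim
    case (elim z)
    have lims: "(\<lambda>n. g n z) \<longlonglongrightarrow> g0 z" "(\<lambda>n. Y n z) \<longlonglongrightarrow> Y0 z"
      unfolding g_def g0_def Y_def Y0_def dilate_def using elim by (auto intro!: tendsto_intros)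
    show ?case
    proof (cases "u z = 0 \<and> g0 z = 0")
      case True
      then have "U0 z = 0" "D0 z = 0"
        using p by (auto simp: U0_def D0_def power_mean_at_0)
      then show ?thesis by simp
    next
      case False
      have "(\<lambda>n. U n z) \<longlonglongrightarrow> U0 z - 0" unfolding U_def U0_def
        by (intro tendsto_diff tendsto_power_mean p \<epsilon>0 elim lims)
      then have "(\<lambda>n. \<bar>U n z\<bar> powr p) \<longlonglongrightarrow> \<bar>U0 z\<bar> powr p"
        using p by (intro tendsto_powr' tendsto_rabs tendsto_const) auto
      moreover have "(\<lambda>n. V n z) \<longlonglongrightarrow> V0 z" unfolding V_def V0_def
        using False by (intro tendsto_mean_gradient p \<epsilon>0 elim lims) auto
      then have "(\<lambda>n. D n z) \<longlonglongrightarrow> (norm (G z) powr p + norm (Y0 z) powr p) / 2 - norm (V0 z) powr p"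
        unfolding D_def using p
        by (intro tendsto_diff tendsto_divide tendsto_add tendsto_powr' tendsto_norm tendsto_const elim lims)
          auto
      then have "(\<lambda>n. D n z) \<longlonglongrightarrow> D0 z" using False by (auto simp: D0_def)
      ultimately have "(\<lambda>n. F n z) \<longlonglongrightarrow> ennreal (\<sigma> * (v z * \<bar>U0 z\<bar> powr p) + w z * D0 z)"
        unfolding F_def by (intro tendsto_ennrealI tendsto_add tendsto_mult tendsto_const)
      then show ?thesis by (simp add: lim_imp_Liminf)
    qed
  qed
  then have "(\<integral>\<^sup>+z. ennreal (\<sigma> * (v z * \<bar>U0 z\<bar> powr p) + w z * D0 z) \<partial>lborel) \<le> weighted_integral a (- b) p G"
    by (intro order_trans[OF nn_integral_mono_AE Fatou])
  moreover have "(\<integral>\<^sup>+z. ennreal (\<sigma> * (v z * \<bar>U0 z\<bar> powr p) + w z * D0 z) \<partial>lborel) =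
     ennreal \<sigma> * weighted_integral (a - p - b + \<gamma>) (- \<gamma>) p U0 + (\<integral>\<^sup>+z. ennreal (w z * D0 z) \<partial>lborel)"
    by (intro split D0_nonneg) auto
  moreover have "weighted_integral (a - p - b + \<gamma>) (- \<gamma>) p U0 = weighted_integral (a - p - b + \<gamma>) (- \<gamma>) p u"
  proof -
    have "U0 z \<ge> 0" for z by (simp add: U0_def power_mean_def)
    then have "norm (U0 z) powr p = (norm (u z) powr p + norm (g0 z) powr p) / 2" for z
      using power_mean_0[OF p, of "u z" "g0 z"] by (simp add: U0_def)
    then show ?thesis
      unfolding weighted_integral_weight[of _ _ _ U0] by (simp only:) (rule average, auto)
  qed
  \<comment> \<open>The attained equality makes the first term the energy itself, which is finite and cancels.\<close>
  ultimately have "weighted_integral a (- b) p G + (\<integral>\<^sup>+z. ennreal (w z * D0 z) \<partial>lborel) \<le> weighted_integral a (- b) p G + 0"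
    using eq unfolding \<sigma> by simp
  then have "(\<integral>\<^sup>+z. ennreal (w z * D0 z) \<partial>lborel) = 0"
    using I by (subst (asm) ennreal_add_left_cancel_le) (auto simp: top_unique)
  then have "AE z in lborel. ennreal (w z * D0 z) = 0"
    by (subst (asm) nn_integral_0_iff_AE) auto
  then show ?thesis using AE_fst_nonzero
  proof eventually_elim
    case (elim z)
    then have "w z > 0" using w0[of z] weight_eq_0_iff[of a "- b" z] unfolding w_def by linarith
    with elim D0_nonneg[of z] have "D0 z = 0"
      by (auto simp: ennreal_eq_0_iff mult_le_0_iff)
    then show ?case
    proof (cases "u z = 0 \<and> g0 z = 0")
      case False
      then have "g0 z *\<^sub>R G z = u z *\<^sub>R Y0 z"
        using \<open>D0 z = 0\<close> by (intro mean_gradient_eq_imp_proportional[OF p]) (auto simp: D0_def V0_def)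
      then show ?thesis by (simp add: g0_def Y0_def)
    qed (simp add: g0_def)
  qed
qed

section \<open>Integration along dilations\<close>

lemma dilate_diff: "dilate \<kappa> s (\<lambda>z. f z - g z) z = dilate \<kappa> s f z - dilate \<kappa> s g z"
  by (simp add: dilate_def scaleR_diff_right)

lemma dilate_has_real_derivative:
  assumes "\<phi> \<in> Cc_infinity"
  shows "((\<lambda>\<tau>. dilate \<kappa> (s * \<tau>) \<phi> z) has_real_derivative
     s * dilate \<kappa> (s * \<tau>) (\<lambda>z. \<kappa> * \<phi> z + z \<bullet> gradient \<phi> z) z) (at \<tau>)"
proof -
  let ?e = "\<lambda>\<tau>. exp (s * \<tau>) *\<^sub>R z"
  have "(\<phi> has_derivative (\<lambda>v. v \<bullet> gradient \<phi> (?e \<tau>))) (at (?e \<tau>))"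
    using GDERIV_gradient[OF Cc_infinity_differentiable[OF assms], of "?e \<tau>"] by (simp add: gderiv_def)
  moreover have "(?e has_derivative (\<lambda>h. (h * (s * exp (s * \<tau>))) *\<^sub>R z)) (at \<tau>)"
    by (auto intro!: derivative_eq_intros)
  ultimately have "((\<lambda>\<tau>. \<phi> (?e \<tau>)) has_derivative
      (\<lambda>h. ((h * (s * exp (s * \<tau>))) *\<^sub>R z) \<bullet> gradient \<phi> (?e \<tau>))) (at \<tau>)"
    by (intro has_derivative_compose[of ?e _ \<tau> UNIV \<phi>]) auto
  then have 1: "((\<lambda>\<tau>. \<phi> (?e \<tau>)) has_real_derivative s * (?e \<tau> \<bullet> gradient \<phi> (?e \<tau>))) (at \<tau>)"
    unfolding has_field_derivative_def
    by (rule has_derivative_eq_rhs) (auto simp: fun_eq_iff mult_ac)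
  show ?thesis unfolding dilate_def real_scaleR_def
    by (rule DERIV_cong, rule DERIV_mult[OF _ 1])
      (auto intro!: derivative_eq_intros simp: algebra_simps)
qed

text \<open>
  The bound is an extended nonnegative integral, so that it can be compared with the integrals that
  Tonelli's theorem provides along orbits.
\<close>

lemma abs_increment_le_nn_integral_deriv:
  fixes F F' :: "real \<Rightarrow> real"
  assumes d: "\<And>t. (F has_real_derivative F' t) (at t)" and c: "continuous_on UNIV F'"
  shows "ennreal \<bar>F 1 - F 0\<bar> \<le> (\<integral>\<^sup>+t. ennreal \<bar>F' t\<bar> * indicator {0..1} t \<partial>lborel)"
proof -
  have "has_bochner_integral lborel (\<lambda>x. F' x * indicator {0 .. 1} x) (F 1 - F 0)"
    using d c by (intro has_bochner_integral_FTC_Icc_real)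
      (auto simp: continuous_on_eq_continuous_at)
  then have "ennreal (norm (F 1 - F 0)) \<le> (\<integral>\<^sup>+x. norm (F' x * indicator {0 .. 1} x) \<partial>lborel)"
    using integral_norm_bound_ennreal by (metis has_bochner_integral_iff)
  also have "\<dots> = (\<integral>\<^sup>+t. ennreal \<bar>F' t\<bar> * indicator {0..1} t \<partial>lborel)"
    by (intro nn_integral_cong) (auto simp: indicator_def)
  finally show ?thesis by simp
qed

text \<open>
  On an interval of length one, \<open>|x| \<le> \<delta> + \<delta>\<^sup>1\<^sup>-\<^sup>p |x|\<^sup>p\<close> for every \<open>\<delta> > 0\<close>.
\<close>

lemma nn_integral_tendsto_0_of_powr:
  fixes f :: "nat \<Rightarrow> real \<Rightarrow> real"
  assumes [measurable]: "\<And>n. f n \<in> borel_measurable borel" and p: "p > 1"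
    and lim: "(\<lambda>n. \<integral>\<^sup>+t. ennreal (\<bar>f n t\<bar> powr p) * indicator {0..1} t \<partial>lborel) \<longlonglongrightarrow> 0"
  shows "(\<lambda>n. \<integral>\<^sup>+t. ennreal \<bar>f n t\<bar> * indicator {0..1} t \<partial>lborel) \<longlonglongrightarrow> 0"
proof (rule order_tendstoI)
  fix e :: ennreal assume "0 < e"
  then obtain \<delta> where \<delta>: "\<delta> > 0" "ennreal (2 * \<delta>) < e"
  proof -
    obtain r where r: "0 < r" "r < e" using \<open>0 < e\<close> dense by blast
    then have "r < top" using top.extremum by (metis order_less_le_trans)
    then have "enn2real r > 0" "ennreal (2 * (enn2real r / 2)) < e"
      using r by (auto simp: enn2real_positive_iff)
    then show thesis using that[of "enn2real r / 2"] by auto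
  qed
  define K where "K = ennreal (\<delta> powr (1 - p))"
  have b: "\<bar>x\<bar> \<le> \<delta> + \<delta> powr (1 - p) * \<bar>x\<bar> powr p" for x :: real
  proof (cases "\<bar>x\<bar> \<le> \<delta>")
    case False
    then have "\<bar>x\<bar> powr (1 - p) \<le> \<delta> powr (1 - p)" using \<delta> p by (intro powr_mono2') auto
    then have "\<bar>x\<bar> powr (1 - p) * \<bar>x\<bar> powr p \<le> \<delta> powr (1 - p) * \<bar>x\<bar> powr p" by (intro mult_right_mono) auto
    then show ?thesis using False \<delta> by (simp flip: powr_add)
  qed (simp add: add_increasing2)
  have le: "(\<integral>\<^sup>+t. ennreal \<bar>f n t\<bar> * indicator {0..1} t \<partial>lborel) \<le>
     ennreal \<delta> + K * (\<integral>\<^sup>+t. ennreal (\<bar>f n t\<bar> powr p) * indicator {0..1} t \<partial>lborel)" for n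
  proof -
    have "(\<integral>\<^sup>+t. ennreal \<bar>f n t\<bar> * indicator {0..1} t \<partial>lborel) \<le>
      (\<integral>\<^sup>+t. ennreal \<delta> * indicator {0..1} t + K * (ennreal (\<bar>f n t\<bar> powr p) * indicator {0..1} t) \<partial>lborel)"
    proof (intro nn_integral_mono)
      fix t
      have "ennreal \<bar>f n t\<bar> \<le> ennreal (\<delta> + \<delta> powr (1 - p) * \<bar>f n t\<bar> powr p)"
        using b by (intro ennreal_leI)
      also have "\<dots> = ennreal \<delta> + K * ennreal (\<bar>f n t\<bar> powr p)"
        using \<delta> by (simp add: K_def ennreal_mult)
      finally show "ennreal \<bar>f n t\<bar> * indicator {0..1} t \<le>
          ennreal \<delta> * indicator {0..1} t + K * (ennreal (\<bar>f n t\<bar> powr p) * indicator {0..1} t)"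
        by (auto simp: indicator_def)
    qed
    also have "\<dots> = ennreal \<delta> + K * (\<integral>\<^sup>+t. ennreal (\<bar>f n t\<bar> powr p) * indicator {0..1} t \<partial>lborel)"
      by (simp add: nn_integral_add nn_integral_cmult nn_integral_cmult_indicator)
    finally show ?thesis .
  qed
  have "(\<lambda>n. K * (\<integral>\<^sup>+t. ennreal (\<bar>f n t\<bar> powr p) * indicator {0..1} t \<partial>lborel)) \<longlonglongrightarrow> K * 0"
    by (intro ennreal_tendsto_cmult lim) (simp add: K_def)
  then have "eventually (\<lambda>n. K * (\<integral>\<^sup>+t. ennreal (\<bar>f n t\<bar> powr p) * indicator {0..1} t \<partial>lborel) < ennreal \<delta>) sequentially"
    using \<delta> by (intro order_tendstoD(2)) auto
  then show "eventually (\<lambda>n. (\<integral>\<^sup>+t. ennreal \<bar>f n t\<bar> * indicator {0..1} t \<partial>lborel) < e) sequentially"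
  proof eventually_elim
    case (elim n)
    have "(\<integral>\<^sup>+t. ennreal \<bar>f n t\<bar> * indicator {0..1} t \<partial>lborel) \<le> ennreal \<delta> + ennreal \<delta>"
      using le[of n] elim by (meson add_left_mono less_imp_le order_trans)
    also have "\<dots> = ennreal (2 * \<delta>)" using \<delta> by (simp flip: ennreal_plus)
    finally show ?case using \<delta> by simp
  qed
qed auto

lemma measurable_dilate_pair [measurable]:
  fixes f :: "'a::euclidean_space \<Rightarrow> 'v::euclidean_space"
  assumes [measurable]: "f \<in> borel_measurable borel"
  shows "(\<lambda>x. dilate \<kappa> (s * snd x) f (fst x)) \<in> borel_measurable (lborel \<Otimes>\<^sub>M lborel)"
  unfolding dilate_def by measurable

text \<open>
  Each dilation is an isometry of the weighted \<open>L\<^sup>p\<close> space, so by Tonelli the integral of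
  \<open>|T\<^sub>s\<^sub>t (f\<^sub>n - g)|\<^sup>p\<close> over \<open>t \<in> [0, 1]\<close> and \<open>z\<close> equals the norm of \<open>f\<^sub>n - g\<close>. Hence almost every
  orbit sees \<open>L\<^sup>p\<close> convergence, and therefore \<open>L\<^sup>1\<close> convergence, in \<open>t\<close>. Orbits take the role that
  rays have in polar coordinates.
\<close>

lemma AE_L1_convergence_along_dilations:
  fixes f :: "nat \<Rightarrow> 'k::euclidean_space \<times> 'm::euclidean_space \<Rightarrow> real"
  assumes [measurable]: "\<And>n. f n \<in> borel_measurable borel" "g \<in> borel_measurable borel" and p: "p > 1"
    and \<kappa>: "\<kappa> * p = real DIM('k \<times> 'm) + \<alpha> + \<beta>"
    and fin: "(\<Sum>n. weighted_integral \<alpha> \<beta> p (\<lambda>z. f n z - g z)) < top"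
  shows "AE z in lborel. (\<lambda>n. \<integral>\<^sup>+t. ennreal \<bar>dilate \<kappa> (s * t) (f n) z - dilate \<kappa> (s * t) g z\<bar> *
     indicator {0..1} t \<partial>lborel) \<longlonglongrightarrow> 0"
proof -
  define e where "e n z = f n z - g z" for n z
  have [measurable]: "e n \<in> borel_measurable borel" for n unfolding e_def[abs_def] by measurable
  have ed: "dilate \<kappa> (s * t) (f n) z - dilate \<kappa> (s * t) g z = dilate \<kappa> (s * t) (e n) z" for n t z
    by (simp add: e_def[abs_def] dilate_diff)
  define w :: "'k \<times> 'm \<Rightarrow> real" where "w = weight \<alpha> \<beta>"
  have [measurable]: "w \<in> borel_measurable borel" by (simp add: w_def)
  have m1: "(\<lambda>t. dilate \<kappa> (s * t) (e n) z) \<in> borel_measurable borel" for n z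
    unfolding dilate_def by measurable
  note [measurable] = m1
  have "(\<integral>\<^sup>+z. \<integral>\<^sup>+t. ennreal (w z * \<bar>dilate \<kappa> (s * t) (e n) z\<bar> powr p) * indicator {0..1} t \<partial>lborel \<partial>lborel) =
     weighted_integral \<alpha> \<beta> p (e n)" for n
  proof -
    have "(\<integral>\<^sup>+z. \<integral>\<^sup>+t. ennreal (w z * \<bar>dilate \<kappa> (s * t) (e n) z\<bar> powr p) * indicator {0..1} t \<partial>lborel \<partial>lborel) =
      (\<integral>\<^sup>+t. \<integral>\<^sup>+z. ennreal (w z * \<bar>dilate \<kappa> (s * t) (e n) z\<bar> powr p) * indicator {0..1} t \<partial>lborel \<partial>lborel)"
      by (rule lborel_pair.Fubini'[symmetric]) (simp add: case_prod_unfold)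
    also have "\<dots> = (\<integral>\<^sup>+t. weighted_integral \<alpha> \<beta> p (e n) * indicator {0..1} (t::real) \<partial>lborel)"
    proof (intro nn_integral_cong)
      fix t
      have "weighted_integral \<alpha> \<beta> p (dilate \<kappa> (s * t) (e n)) = weighted_integral \<alpha> \<beta> p (e n)"
        by (rule weighted_integral_dilate[OF _ \<kappa>]) simp
      then show "(\<integral>\<^sup>+z. ennreal (w z * \<bar>dilate \<kappa> (s * t) (e n) z\<bar> powr p) * indicator {0..1} t \<partial>lborel) =
          weighted_integral \<alpha> \<beta> p (e n) * indicator {0..1} t"
        by (subst nn_integral_multc) (auto simp: weighted_integral_weight w_def)
    qed
    also have "\<dots> = weighted_integral \<alpha> \<beta> p (e n)" by (subst nn_integral_cmult_indicator) auto
    finally show ?thesis .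
  qed
  moreover have [measurable]: "(\<lambda>z. \<integral>\<^sup>+t. ennreal (w z * \<bar>dilate \<kappa> (s * t) (e n) z\<bar> powr p) *
      indicator {0..1} t \<partial>lborel) \<in> borel_measurable borel" for n
  proof -
    have "(\<lambda>z. \<integral>\<^sup>+t. ennreal (w z * \<bar>dilate \<kappa> (s * t) (e n) z\<bar> powr p) *
      indicator {0..1} t \<partial>lborel) \<in> borel_measurable (lborel :: ('k \<times> 'm) measure)"
      by (rule lborel.borel_measurable_nn_integral) (simp add: case_prod_unfold)
    then show ?thesis by simp
  qed
  ultimately have "(\<integral>\<^sup>+z. (\<Sum>n. \<integral>\<^sup>+t. ennreal (w z * \<bar>dilate \<kappa> (s * t) (e n) z\<bar> powr p) *
      indicator {0..1} t \<partial>lborel) \<partial>lborel) < top"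
    using fin by (subst nn_integral_suminf) (auto simp: e_def[abs_def])
  then have "AE z in lborel. (\<Sum>n. \<integral>\<^sup>+t. ennreal (w z * \<bar>dilate \<kappa> (s * t) (e n) z\<bar> powr p) *
      indicator {0..1} t \<partial>lborel) \<noteq> \<infinity>"
    by (intro nn_integral_PInf_AE) auto
  then show ?thesis using AE_fst_nonzero
  proof eventually_elim
    case (elim z)
    have w: "w z > 0" using elim weight_nonneg[of \<alpha> \<beta> z] weight_eq_0_iff[of \<alpha> \<beta> z]
      unfolding w_def by linarith
    have "(\<lambda>n. \<integral>\<^sup>+t. ennreal (w z * \<bar>dilate \<kappa> (s * t) (e n) z\<bar> powr p) * indicator {0..1} t \<partial>lborel) \<longlonglongrightarrow> 0"
      using elim by (intro suminf_ennreal_finite_imp_tendsto_0) (simp add: less_top)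
    from ennreal_tendsto_cmult[OF _ this, of "ennreal (1 / w z)"]
    have "(\<lambda>n. ennreal (1 / w z) * (\<integral>\<^sup>+t. ennreal (w z * \<bar>dilate \<kappa> (s * t) (e n) z\<bar> powr p) *
        indicator {0..1} t \<partial>lborel)) \<longlonglongrightarrow> 0" by simp
    also have "(\<lambda>n. ennreal (1 / w z) * (\<integral>\<^sup>+t. ennreal (w z * \<bar>dilate \<kappa> (s * t) (e n) z\<bar> powr p) *
        indicator {0..1} t \<partial>lborel)) =
      (\<lambda>n. \<integral>\<^sup>+t. ennreal (\<bar>dilate \<kappa> (s * t) (e n) z\<bar> powr p) * indicator {0..1} t \<partial>lborel)"
      using w by (subst nn_integral_cmult[symmetric])
        (auto simp: mult.assoc[symmetric] ennreal_mult[symmetric] intro!: ext nn_integral_cong)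
    finally show ?case unfolding ed by (intro nn_integral_tendsto_0_of_powr[OF _ p]) auto
  qed
qed

lemma weighted_integral_cmult:
  fixes f :: "'k::euclidean_space \<times> 'm::euclidean_space \<Rightarrow> real"
  assumes [measurable]: "f \<in> borel_measurable borel"
  shows "weighted_integral \<alpha> \<beta> p (\<lambda>z. c * f z) = ennreal (\<bar>c\<bar> powr p) * weighted_integral \<alpha> \<beta> p f"
  unfolding weighted_integral_weight
  by (subst nn_integral_cmult[symmetric])
    (auto simp: abs_mult powr_mult ennreal_mult[symmetric] mult_ac intro!: nn_integral_cong)

lemma weighted_integral_inner_le:
  assumes "p > 0"
  shows "weighted_integral \<alpha> (\<beta> - p) p (\<lambda>z. z \<bullet> E z) \<le> weighted_integral \<alpha> \<beta> p E"
  unfolding weighted_integral_def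
proof (intro nn_integral_mono ennreal_leI)
  fix z :: "'a \<times> 'b"
  show "norm (fst z) powr \<alpha> * norm z powr (\<beta> - p) * norm (z \<bullet> E z) powr p \<le>
     norm (fst z) powr \<alpha> * norm z powr \<beta> * norm (E z) powr p"
  proof (cases "z = 0")
    case False
    have "norm (z \<bullet> E z) powr p \<le> (norm z * norm (E z)) powr p"
      using assms by (intro powr_mono2) (auto simp: Cauchy_Schwarz_ineq2)
    then have "norm (fst z) powr \<alpha> * norm z powr (\<beta> - p) * norm (z \<bullet> E z) powr p \<le>
      norm (fst z) powr \<alpha> * norm z powr (\<beta> - p) * (norm z * norm (E z)) powr p"
      by (intro mult_left_mono) auto
    also have "\<dots> = norm (fst z) powr \<alpha> * norm z powr \<beta> * norm (E z) powr p"
      using False by (simp add: powr_mult powr_diff)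
    finally show ?thesis .
  qed simp
qed

text \<open>
  With \<open>\<psi> = H u + z \<bullet> G\<close>, the generator of the dilations applied to \<open>u\<close>, the assumption becomes
  \<open>T\<^sub>s\<^sub>t u \<cdot> \<psi> = u \<cdot> T\<^sub>s\<^sub>t \<psi>\<close>, so on almost every orbit through a point with \<open>u \<noteq> 0\<close> the quotient
  \<open>c = \<psi> / u\<close> satisfies \<open>T\<^sub>s\<^sub>t \<psi> = c T\<^sub>s\<^sub>t u\<close>. For the approximating test functions,
  \<open>e\<^sup>-\<^sup>c\<^sup>s\<^sup>t T\<^sub>s\<^sub>t \<phi>\<^sub>n (z)\<close> is differentiable in \<open>t\<close>, with a derivative that tends to \<open>0\<close> in
  \<open>L\<^sup>1[0, 1]\<close>. Its values at \<open>0\<close> and \<open>1\<close> thus agree in the limit, without any regularity of \<open>u\<close>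
  along the orbit.
\<close>

lemma dilate_eq_exp_if_gradient_proportional:
  fixes u :: "'k::euclidean_space \<times> 'm::euclidean_space \<Rightarrow> real" and p a b H s :: real
  assumes p: "p > 1" and H: "H * p = real DIM('k \<times> 'm) + a - b - p"
    and uG: "(u, G) \<in> D1p p a b"
    and proportional: "\<And>s. AE z in lborel. dilate H s u z *\<^sub>R G z = u z *\<^sub>R dilate (H + 1) s G z"
  shows "AE z in lborel. u z \<noteq> 0 \<longrightarrow> dilate H s u z = exp (s * (H + (z \<bullet> G z) / u z)) * u z"
proof -
  have [measurable]: "u \<in> borel_measurable borel" "G \<in> borel_measurable borel"
    using uG by (auto simp: D1p_def)
  obtain \<phi> where \<phi>: "\<And>n. \<phi> n \<in> Cc_infinity"
    and \<phi>G: "\<And>n. weighted_integral a (- b) p (\<lambda>z. gradient (\<phi> n) z - G z) \<le> ennreal ((1/2) ^ n)"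
    and \<phi>u: "\<And>n. weighted_integral a (- b - p) p (\<lambda>z. \<phi> n z - u z) \<le> ennreal ((1/2) ^ n)"
    using D1p_fast_approximation[OF uG] by blast
  have c\<phi>: "continuous_on UNIV (\<phi> n)" "continuous_on UNIV (gradient (\<phi> n))" for n
    by (auto intro!: Cc_infinity_continuous continuous_on_gradient \<phi>)
  have [measurable]: "\<phi> n \<in> borel_measurable borel" "gradient (\<phi> n) \<in> borel_measurable borel" for n
    by (auto intro!: borel_measurable_continuous_onI c\<phi>)
  define \<psi> where "\<psi> z = H * u z + z \<bullet> G z" for z
  define \<psi>n where "\<psi>n n z = H * \<phi> n z + z \<bullet> gradient (\<phi> n) z" for n z
  have [measurable]: "\<psi> \<in> borel_measurable borel" "\<psi>n n \<in> borel_measurable borel" for n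
    unfolding \<psi>_def[abs_def] \<psi>n_def[abs_def] by measurable
  have c\<psi>: "continuous_on UNIV (\<psi>n n)" for n
    unfolding \<psi>n_def[abs_def] by (intro continuous_intros c\<phi>)
  have Hw: "H * p = real DIM('k \<times> 'm) + a + (- b - p)" using H by simp
  have fin_u: "(\<Sum>n. weighted_integral a (- b - p) p (\<lambda>z. \<phi> n z - u z)) < top"
    by (rule suminf_le_geometric_finite[OF \<phi>u])
  have fin_\<psi>: "(\<Sum>n. weighted_integral a (- b - p) p (\<lambda>z. \<psi>n n z - \<psi> z)) < top"
  proof (rule suminf_le_cmult_geometric_finite)
    let ?c = "ennreal ((1/2) powr (1 - p))" and ?h = "ennreal (\<bar>H\<bar> powr p)"
    fix n
    have "weighted_integral a (- b - p) p (\<lambda>z. \<psi>n n z - \<psi> z) =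
        weighted_integral a (- b - p) p (\<lambda>z. H * (\<phi> n z - u z) + z \<bullet> (gradient (\<phi> n) z - G z))"
      by (simp add: \<psi>n_def \<psi>_def algebra_simps inner_diff_right)
    also have "\<dots> \<le> ?c * weighted_integral a (- b - p) p (\<lambda>z. H * (\<phi> n z - u z)) +
        ?c * weighted_integral a (- b - p) p (\<lambda>z. z \<bullet> (gradient (\<phi> n) z - G z))"
      by (rule order_trans[OF weighted_integral_add_le[where \<theta> = "1/2"]]) (use p in auto)
    also have "\<dots> \<le> ?c * (?h * ennreal ((1/2) ^ n)) + ?c * ennreal ((1/2) ^ n)"
    proof (intro add_mono mult_left_mono)
      show "weighted_integral a (- b - p) p (\<lambda>z. H * (\<phi> n z - u z)) \<le> ?h * ennreal ((1/2) ^ n)"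
        by (subst weighted_integral_cmult) (auto intro!: mult_left_mono \<phi>u)
      show "weighted_integral a (- b - p) p (\<lambda>z. z \<bullet> (gradient (\<phi> n) z - G z)) \<le> ennreal ((1/2) ^ n)"
        using p by (intro order_trans[OF weighted_integral_inner_le \<phi>G]) auto
    qed auto
    also have "\<dots> = (?c * ?h + ?c) * ennreal ((1/2) ^ n)" by (simp add: distrib_right mult.assoc)
    finally show "weighted_integral a (- b - p) p (\<lambda>z. \<psi>n n z - \<psi> z) \<le> (?c * ?h + ?c) * ennreal ((1/2) ^ n)" .
  qed (auto simp: ennreal_mult_less_top)
  have lim_u: "AE z in lborel. (\<lambda>n. \<phi> n z) \<longlonglongrightarrow> u z"
  proof -
    have "AE z in lborel. (\<lambda>n. \<phi> n z - u z) \<longlonglongrightarrow> 0"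
      by (rule weighted_integral_summable_imp_AE_tendsto_0[OF _ _ fin_u]) (use p in auto)
    then show ?thesis by (simp add: LIM_zero_iff)
  qed
  have cross: "AE z in lborel. AE t in lborel. dilate H (s * t) u z * \<psi> z = u z * dilate H (s * t) \<psi> z"
  proof (subst lborel_pair.AE_commute)
    have "AE z in lborel. dilate H (s * t) u z * \<psi> z = u z * dilate H (s * t) \<psi> z" for t
      using proportional[of "s * t"]
    proof (rule eventually_mono)
      fix z assume *: "dilate H (s * t) u z *\<^sub>R G z = u z *\<^sub>R dilate (H + 1) (s * t) G z"
      have "dilate H (s * t) \<psi> z = H * dilate H (s * t) u z + z \<bullet> dilate (H + 1) (s * t) G z"
        by (simp add: \<psi>_def dilate_def distrib_right exp_add algebra_simps)
      moreover have "z \<bullet> (dilate H (s * t) u z *\<^sub>R G z) = z \<bullet> (u z *\<^sub>R dilate (H + 1) (s * t) G z)"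
        by (simp only: *)
      ultimately show "dilate H (s * t) u z * \<psi> z = u z * dilate H (s * t) \<psi> z"
        by (simp add: \<psi>_def algebra_simps)
    qed
    then show "AE t in lborel. AE z in lborel. dilate H (s * t) u z * \<psi> z = u z * dilate H (s * t) \<psi> z"
      by simp
    have "(\<lambda>x. dilate H (s * snd x) u (fst x) * \<psi> (fst x)) \<in> borel_measurable (lborel \<Otimes>\<^sub>M lborel)"
         "(\<lambda>x. u (fst x) * dilate H (s * snd x) \<psi> (fst x)) \<in> borel_measurable (lborel \<Otimes>\<^sub>M lborel)"
      by measurable
    then show "{x \<in> space (lborel \<Otimes>\<^sub>M lborel). dilate H (s * snd x) u (fst x) * \<psi> (fst x) =
        u (fst x) * dilate H (s * snd x) \<psi> (fst x)} \<in> sets (lborel \<Otimes>\<^sub>M lborel)"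
      by (rule borel_measurable_eq)
  qed
  have L1_u: "AE z in lborel. (\<lambda>n. \<integral>\<^sup>+t. ennreal \<bar>dilate H (s * t) (\<phi> n) z - dilate H (s * t) u z\<bar> *
      indicator {0..1} t \<partial>lborel) \<longlonglongrightarrow> 0"
    by (rule AE_L1_convergence_along_dilations[OF _ _ p Hw fin_u]) measurable
  have L1_\<psi>: "AE z in lborel. (\<lambda>n. \<integral>\<^sup>+t. ennreal \<bar>dilate H (s * t) (\<psi>n n) z - dilate H (s * t) \<psi> z\<bar> *
      indicator {0..1} t \<partial>lborel) \<longlonglongrightarrow> 0"
    by (rule AE_L1_convergence_along_dilations[OF _ _ p Hw fin_\<psi>]) measurable
  show ?thesis
    using lim_u AE_lborel_scaleR[OF lim_u exp_gt_zero[of s]] cross L1_u L1_\<psi>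
  proof eventually_elim
    case (elim z)
    show ?case
    proof
      assume nz: "u z \<noteq> 0"
      define c where "c = \<psi> z / u z"
      define q where "q n t = dilate H (s * t) (\<phi> n) z" for n t
      define h where "h n t = dilate H (s * t) (\<psi>n n) z" for n t
      define q0 where "q0 t = dilate H (s * t) u z" for t
      define h0 where "h0 t = dilate H (s * t) \<psi> z" for t
      have [measurable]: "q n \<in> borel_measurable borel" "h n \<in> borel_measurable borel"
        "q0 \<in> borel_measurable borel" "h0 \<in> borel_measurable borel" for n
        unfolding q_def[abs_def] h_def[abs_def] q0_def[abs_def] h0_def[abs_def] dilate_def
        by measurable
      have q0h0: "AE t in lborel. h0 t = c * q0 t"
        using elim(3) by (rule eventually_mono) (use nz in \<open>auto simp: c_def q0_def h0_def field_simps\<close>)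
      define F where "F n t = exp (- (c * s * t)) * q n t" for n t
      define F' where "F' n t = exp (- (c * s * t)) * (s * (h n t - c * q n t))" for n t
      have dF: "(F n has_real_derivative F' n t) (at t)" for n t
      proof -
        have "(q n has_real_derivative s * h n t) (at t)"
          using dilate_has_real_derivative[OF \<phi>, of H s n z t]
          unfolding q_def[abs_def] h_def[abs_def] \<psi>n_def[abs_def] .
        then show ?thesis unfolding F_def[abs_def] F'_def
          by (auto intro!: derivative_eq_intros simp: algebra_simps)
      qed
      have cF: "continuous_on UNIV (F' n)" for n
        unfolding F'_def[abs_def] h_def[abs_def] q_def[abs_def] dilate_def
        by (intro continuous_intros continuous_on_compose2[OF c\<psi>] continuous_on_compose2[OF c\<phi>(1)]) auto
      define K where "K = exp \<bar>c * s\<bar> * \<bar>s\<bar>"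
      have bound: "ennreal \<bar>F n 1 - F n 0\<bar> \<le>
        ennreal K * ((\<integral>\<^sup>+t. ennreal \<bar>h n t - h0 t\<bar> * indicator {0..1} t \<partial>lborel) +
          ennreal \<bar>c\<bar> * (\<integral>\<^sup>+t. ennreal \<bar>q n t - q0 t\<bar> * indicator {0..1} t \<partial>lborel))" for n
      proof -
        have "ennreal \<bar>F n 1 - F n 0\<bar> \<le> (\<integral>\<^sup>+t. ennreal \<bar>F' n t\<bar> * indicator {0..1} t \<partial>lborel)"
          by (rule abs_increment_le_nn_integral_deriv[OF dF cF])
        also have "\<dots> \<le> (\<integral>\<^sup>+t. ennreal K * (ennreal \<bar>h n t - h0 t\<bar> * indicator {0..1} t +
            ennreal \<bar>c\<bar> * (ennreal \<bar>q n t - q0 t\<bar> * indicator {0..1} t)) \<partial>lborel)"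
        proof (intro nn_integral_mono_AE, use q0h0 in eventually_elim)
          fix t assume t: "h0 t = c * q0 t"
          show "ennreal \<bar>F' n t\<bar> * indicator {0..1} t \<le> ennreal K * (ennreal \<bar>h n t - h0 t\<bar> * indicator {0..1} t +
            ennreal \<bar>c\<bar> * (ennreal \<bar>q n t - q0 t\<bar> * indicator {0..1} t))"
          proof (cases "t \<in> {0..1}")
            case True
            have "- (c * s * t) \<le> \<bar>c * s\<bar> * t" using True
              by (metis abs_ge_minus_self atLeastAtMost_iff minus_mult_left mult_right_mono)
            also have "\<dots> \<le> \<bar>c * s\<bar>" using True by (simp add: mult_left_le)
            finally have e: "exp (- (c * s * t)) \<le> exp \<bar>c * s\<bar>" by simp
            \<comment> \<open>The exact relation between the limits lets only the two approximation errors remain.\<close>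
            have "h n t - c * q n t = (h n t - h0 t) - c * (q n t - q0 t)" using t by (simp add: algebra_simps)
            then have "\<bar>h n t - c * q n t\<bar> \<le> \<bar>h n t - h0 t\<bar> + \<bar>c\<bar> * \<bar>q n t - q0 t\<bar>"
              by (metis abs_mult abs_triangle_ineq4)
            then have "exp (- (c * s * t)) * (\<bar>s\<bar> * \<bar>h n t - c * q n t\<bar>) \<le>
                exp \<bar>c * s\<bar> * (\<bar>s\<bar> * (\<bar>h n t - h0 t\<bar> + \<bar>c\<bar> * \<bar>q n t - q0 t\<bar>))"
              using e by (intro mult_mono) (auto intro: mult_left_mono)
            then have "\<bar>F' n t\<bar> \<le> K * (\<bar>h n t - h0 t\<bar> + \<bar>c\<bar> * \<bar>q n t - q0 t\<bar>)"
              by (simp add: F'_def K_def abs_mult mult.assoc)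
            then have "ennreal \<bar>F' n t\<bar> \<le> ennreal (K * (\<bar>h n t - h0 t\<bar> + \<bar>c\<bar> * \<bar>q n t - q0 t\<bar>))"
              by (rule ennreal_leI)
            also have "\<dots> = ennreal K * (ennreal \<bar>h n t - h0 t\<bar> + ennreal \<bar>c\<bar> * ennreal \<bar>q n t - q0 t\<bar>)"
              by (simp add: K_def ennreal_mult)
            finally show ?thesis using True by simp
          qed simp
        qed
        also have "\<dots> = ennreal K * ((\<integral>\<^sup>+t. ennreal \<bar>h n t - h0 t\<bar> * indicator {0..1} t \<partial>lborel) +
          ennreal \<bar>c\<bar> * (\<integral>\<^sup>+t. ennreal \<bar>q n t - q0 t\<bar> * indicator {0..1} t \<partial>lborel))"
          by (simp add: nn_integral_cmult nn_integral_add)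
        finally show ?thesis .
      qed
      have L: "(\<lambda>n. \<integral>\<^sup>+t. ennreal \<bar>h n t - h0 t\<bar> * indicator {0..1} t \<partial>lborel) \<longlonglongrightarrow> 0"
        "(\<lambda>n. \<integral>\<^sup>+t. ennreal \<bar>q n t - q0 t\<bar> * indicator {0..1} t \<partial>lborel) \<longlonglongrightarrow> 0"
        using elim(4,5) by (auto simp: h_def q_def h0_def q0_def)
      have lim: "(\<lambda>n. ennreal K * ((\<integral>\<^sup>+t. ennreal \<bar>h n t - h0 t\<bar> * indicator {0..1} t \<partial>lborel) +
          ennreal \<bar>c\<bar> * (\<integral>\<^sup>+t. ennreal \<bar>q n t - q0 t\<bar> * indicator {0..1} t \<partial>lborel)))
          \<longlonglongrightarrow> ennreal K * (0 + ennreal \<bar>c\<bar> * 0)"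
        by (intro ennreal_tendsto_cmult tendsto_add L) auto
      have "(\<lambda>n. ennreal \<bar>F n 1 - F n 0\<bar>) \<longlonglongrightarrow> ennreal K * (0 + ennreal \<bar>c\<bar> * 0)"
        by (rule tendsto_sandwich[OF _ _ _ lim, of "\<lambda>_. 0"])
          (use bound in auto)
      then have "(\<lambda>n. ennreal \<bar>F n 1 - F n 0\<bar>) \<longlonglongrightarrow> 0" by simp
      then have "(\<lambda>n. \<bar>F n 1 - F n 0\<bar>) \<longlonglongrightarrow> 0"
        by (subst (asm) ennreal_0[symmetric], subst (asm) tendsto_ennreal_iff) auto
      moreover have "(\<lambda>n. \<bar>F n 1 - F n 0\<bar>) \<longlonglongrightarrow> \<bar>exp (- (c * s)) * dilate H s u z - u z\<bar>"
        unfolding F_def q_def dilate_def using elim(1,2) by (auto intro!: tendsto_intros)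
      ultimately have "\<bar>exp (- (c * s)) * dilate H s u z - u z\<bar> = 0" by (rule LIMSEQ_unique[symmetric])
      then have "exp (c * s) * u z = exp (c * s) * (exp (- (c * s)) * dilate H s u z)" by simp
      also have "\<dots> = dilate H s u z" by (simp add: exp_minus)
      finally show "dilate H s u z = exp (s * (H + (z \<bullet> G z) / u z)) * u z"
        using nz by (simp add: c_def \<psi>_def add_divide_distrib mult.commute)
    qed
  qed
qed

section \<open>Homogeneous functions of finite norm\<close>

lemma weighted_integral_eq_0_iff:
  fixes f :: "'k::euclidean_space \<times> 'm::euclidean_space \<Rightarrow> 'v::euclidean_space"
  assumes [measurable]: "f \<in> borel_measurable borel"
  shows "weighted_integral \<alpha> \<beta> p f = 0 \<longleftrightarrow> (AE z in lborel. f z = 0)"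
proof -
  have "weighted_integral \<alpha> \<beta> p f = 0 \<longleftrightarrow>
      (AE z in lborel. ennreal (weight \<alpha> \<beta> z * norm (f z) powr p) = 0)"
    unfolding weighted_integral_weight by (rule nn_integral_0_iff_AE) measurable
  also have "\<dots> \<longleftrightarrow> (AE z in lborel. f z = 0)"
  proof
    assume "AE z in lborel. ennreal (weight \<alpha> \<beta> z * norm (f z) powr p) = 0"
    then show "AE z in lborel. f z = 0" using AE_fst_nonzero
    proof eventually_elim
      case (elim z)
      then have "weight \<alpha> \<beta> z * norm (f z) powr p = 0"
        by (metis ennreal_eq_0_iff mult_nonneg_nonneg order_antisym powr_ge_zero weight_nonneg)
      then show ?case using elim by (auto simp: weight_eq_0_iff)
    qed
  qed (auto elim!: eventually_mono)
  finally show ?thesis .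
qed

text \<open>
  Invariance gives the balls of radius \<open>R\<close> and \<open>e R\<close> the same share of the norm. Shrinking the ball,
  this share is \<open>0\<close>; enlarging it, the whole norm is.
\<close>

lemma dilation_invariant_imp_zero:
  fixes u :: "'k::euclidean_space \<times> 'm::euclidean_space \<Rightarrow> real"
  assumes [measurable]: "u \<in> borel_measurable borel" and p: "p > 1"
    and \<kappa>: "\<kappa> * p = real DIM('k \<times> 'm) + \<alpha> + \<beta>"
    and fin: "weighted_integral \<alpha> \<beta> p u < top"
    and inv: "AE z in lborel. dilate \<kappa> (- 1) u z = u z"
  shows "AE z in lborel. u z = 0"
proof -
  define A where "A R = weighted_integral \<alpha> \<beta> p (\<lambda>z. u z * indicator (cball 0 R) z)" for R
  have [measurable]: "cball (0::'k \<times> 'm) R \<in> sets borel" for R by simp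
  have step: "A R = A (exp 1 * R)" for R
  proof -
    have "A R = weighted_integral \<alpha> \<beta> p (dilate \<kappa> (- 1) (\<lambda>z. u z * indicator (cball 0 R) z))"
      unfolding A_def by (rule weighted_integral_dilate[OF _ \<kappa>, symmetric]) measurable
    also have "\<dots> = A (exp 1 * R)" unfolding A_def weighted_integral_weight
    proof (intro nn_integral_cong_AE, use inv in eventually_elim)
      fix z assume z: "dilate \<kappa> (- 1) u z = u z"
      have "indicator (cball 0 R) (exp (- 1) *\<^sub>R z) = (indicator (cball 0 (exp 1 * R)) z :: real)"
        by (auto simp: indicator_def exp_minus field_simps)
      then have "dilate \<kappa> (- 1) (\<lambda>z. u z * indicator (cball 0 R) z) z =
          dilate \<kappa> (- 1) u z * indicator (cball 0 (exp 1 * R)) z"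
        by (simp add: dilate_def)
      then show "ennreal (weight \<alpha> \<beta> z * norm (dilate \<kappa> (- 1) (\<lambda>z. u z * indicator (cball 0 R) z) z) powr p) =
          ennreal (weight \<alpha> \<beta> z * norm (u z * indicator (cball 0 (exp 1 * R)) z) powr p)"
        by (simp only: z)
    qed
    finally show ?thesis .
  qed
  have scale: "A R = A (exp (real j) * R)" for j R
  proof (induction j)
    case (Suc j)
    then show ?case using step[of "exp (real j) * R"] by (simp add: exp_add mult_ac)
  qed simp
  have "(\<lambda>j. A (exp (- real j))) \<longlonglongrightarrow> (\<integral>\<^sup>+z. 0 \<partial>(lborel :: ('k \<times> 'm) measure))"
    unfolding A_def weighted_integral_weight
  proof (rule nn_integral_dominated_convergence[where w = "\<lambda>z. ennreal (weight \<alpha> \<beta> z * norm (u z) powr p)"])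
    show "AE z in lborel. ennreal (weight \<alpha> \<beta> z * norm (u z * indicator (cball 0 (exp (- real j))) z) powr p) \<le>
       ennreal (weight \<alpha> \<beta> z * norm (u z) powr p)" for j
      using p by (intro AE_I2 ennreal_leI mult_left_mono powr_mono2) (auto simp: indicator_def)
    show "(\<integral>\<^sup>+z. ennreal (weight \<alpha> \<beta> z * norm (u z) powr p) \<partial>lborel) < \<infinity>"
      using fin by (simp add: weighted_integral_weight)
    show "AE z::'k \<times> 'm in lborel. (\<lambda>j. ennreal (weight \<alpha> \<beta> z * norm (u z * indicator (cball 0 (exp (- real j))) z) powr p))
        \<longlonglongrightarrow> 0"
      using AE_fst_nonzero
    proof eventually_elim
      case (elim z)
      then have z: "norm z > 0" by auto
      have "(\<lambda>j. exp (- 1) ^ j) \<longlonglongrightarrow> (0::real)" by (rule LIMSEQ_power_zero) simp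
      then have "eventually (\<lambda>j. exp (- 1) ^ j < norm z) sequentially"
        using z by (rule order_tendstoD)
      then have "eventually (\<lambda>j. ennreal (weight \<alpha> \<beta> z * norm (u z * indicator (cball 0 (exp (- real j))) z) powr p) = 0) sequentially"
        by (rule eventually_mono) (auto simp: exp_of_nat_mult[symmetric])
      then show ?case by (rule tendsto_eventually)
    qed
  qed auto
  moreover have "A (exp (- real j)) = A 1" for j
    using scale[of "exp (- real j)" j] by (simp flip: exp_add)
  ultimately have "A 1 = 0" by (simp add: LIMSEQ_const_iff)
  then have "A (exp (real j)) = 0" for j using scale[of 1 j] by simp
  then have "AE z in lborel. u z * indicator (cball 0 (exp (real j))) z = 0" for j
    unfolding A_def by (subst (asm) weighted_integral_eq_0_iff) auto
  then have "AE z in lborel. \<forall>j. u z * indicator (cball 0 (exp (real j))) z = 0"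
    unfolding AE_all_countable by blast
  then show ?thesis
  proof (rule eventually_mono)
    fix z assume *: "\<forall>j. u z * indicator (cball 0 (exp (real j))) z = 0"
    obtain j :: nat where j: "norm z \<le> real j" using real_arch_simple by blast
    also have "real j \<le> exp (real j)" using exp_ge_add_one_self[of "real j"] by linarith
    finally show "u z = 0" using * by (auto simp: indicator_def dest!: spec[of _ j])
  qed
qed

lemma exp_add_exp_minus_ge_2:
  fixes x :: real
  shows "exp x + exp (- x) \<ge> 2" and "exp x + exp (- x) = 2 \<Longrightarrow> x = 0"
proof -
  have "exp x = (exp (x/2))\<^sup>2" "exp (- x) = (exp (- x/2))\<^sup>2" "exp (x/2) * exp (- x/2) = 1"
    using exp_double[of "x/2"] exp_double[of "- x/2"] by (simp_all flip: exp_add)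
  then have *: "exp x + exp (- x) - 2 = (exp (x/2) - exp (- x/2))\<^sup>2"
    by (simp add: power2_diff)
  then show "exp x + exp (- x) \<ge> 2" by (metis diff_ge_0_iff_ge zero_le_power2)
  assume "exp x + exp (- x) = 2"
  then have "exp (x/2) = exp (- x/2)" using * by simp
  then show "x = 0" by simp
qed

text \<open>
  The three functions \<open>u\<close>, \<open>T\<^sub>1 u\<close> and \<open>T\<^sub>-\<^sub>1 u\<close> have equal norms, while pointwise
  \<open>|T\<^sub>1 u|\<^sup>p + |T\<^sub>-\<^sub>1 u|\<^sup>p - 2 |u|\<^sup>p = (e\<^sup>p\<^sup>c + e\<^sup>-\<^sup>p\<^sup>c - 2) |u|\<^sup>p \<ge> 0\<close> where \<open>u \<noteq> 0\<close>. So this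
  difference vanishes, which makes \<open>c = 0\<close> on \<open>{u \<noteq> 0}\<close> and \<open>T\<^sub>-\<^sub>1 u = 0\<close> on \<open>{u = 0}\<close>.
\<close>

lemma dilate_eq_exp_imp_zero:
  fixes u :: "'k::euclidean_space \<times> 'm::euclidean_space \<Rightarrow> real"
  assumes [measurable]: "u \<in> borel_measurable borel" and p: "p > 1"
    and \<kappa>: "\<kappa> * p = real DIM('k \<times> 'm) + \<alpha> + \<beta>"
    and fin: "weighted_integral \<alpha> \<beta> p u < top"
    and law: "\<And>s. AE z in lborel. u z \<noteq> 0 \<longrightarrow> dilate \<kappa> s u z = exp (s * c z) * u z"
  shows "AE z in lborel. u z = 0"
proof (rule dilation_invariant_imp_zero[OF assms(1) p \<kappa> fin])
  define w :: "'k \<times> 'm \<Rightarrow> real" where "w = weight \<alpha> \<beta>"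
  have [measurable]: "w \<in> borel_measurable borel" by (simp add: w_def)
  have w0: "w z \<ge> 0" for z by (simp add: w_def)
  define E where "E z = \<bar>dilate \<kappa> 1 u z\<bar> powr p + \<bar>dilate \<kappa> (- 1) u z\<bar> powr p - 2 * \<bar>u z\<bar> powr p" for z
  have [measurable]: "E \<in> borel_measurable borel" unfolding E_def[abs_def] by measurable
  have E: "AE z in lborel. 0 \<le> E z \<and> (E z = 0 \<longrightarrow> dilate \<kappa> (- 1) u z = u z)"
    using law[of 1] law[of "- 1"]
  proof eventually_elim
    case (elim z)
    show ?case
    proof (cases "u z = 0")
      case True
      have "x powr p = 0 \<longleftrightarrow> x = 0" "x powr p \<ge> 0" for x :: real by auto
      then show ?thesis using True p unfolding E_def by (simp add: add_nonneg_eq_0_iff)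
    next
      case False
      then have d: "dilate \<kappa> 1 u z = exp (c z) * u z" "dilate \<kappa> (- 1) u z = exp (- c z) * u z"
        using elim by auto
      have "E z = (exp (p * c z) + exp (- (p * c z)) - 2) * \<bar>u z\<bar> powr p"
        unfolding E_def d by (simp add: abs_mult powr_mult powr_def[of "exp _"] algebra_simps)
      then show ?thesis
        using exp_add_exp_minus_ge_2[of "p * c z"] False p d by auto
    qed
  qed
  have dil: "weighted_integral \<alpha> \<beta> p (dilate \<kappa> s u) = weighted_integral \<alpha> \<beta> p u" for s
    by (rule weighted_integral_dilate[OF _ \<kappa>]) measurable
  have "(weighted_integral \<alpha> \<beta> p u + weighted_integral \<alpha> \<beta> p u) + (\<integral>\<^sup>+z. ennreal (w z * E z) \<partial>lborel) =
    (\<integral>\<^sup>+z. ennreal (w z * E z) + (ennreal (w z * \<bar>u z\<bar> powr p) + ennreal (w z * \<bar>u z\<bar> powr p)) \<partial>lborel)"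
    by (simp add: nn_integral_add weighted_integral_weight w_def add.commute)
  also have "\<dots> = (\<integral>\<^sup>+z. ennreal (w z * \<bar>dilate \<kappa> 1 u z\<bar> powr p) + ennreal (w z * \<bar>dilate \<kappa> (- 1) u z\<bar> powr p) \<partial>lborel)"
  proof (intro nn_integral_cong_AE, use E in eventually_elim)
    fix z assume z: "0 \<le> E z \<and> (E z = 0 \<longrightarrow> dilate \<kappa> (- 1) u z = u z)"
    have "ennreal (w z * E z) + (ennreal (w z * \<bar>u z\<bar> powr p) + ennreal (w z * \<bar>u z\<bar> powr p)) =
        ennreal (w z * E z + (w z * \<bar>u z\<bar> powr p + w z * \<bar>u z\<bar> powr p))"
      using z w0 by (simp del: ennreal_plus add: ennreal_plus[symmetric])
    also have "w z * E z + (w z * \<bar>u z\<bar> powr p + w z * \<bar>u z\<bar> powr p) =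
        w z * \<bar>dilate \<kappa> 1 u z\<bar> powr p + w z * \<bar>dilate \<kappa> (- 1) u z\<bar> powr p"
      by (simp add: E_def algebra_simps)
    also have "ennreal \<dots> = ennreal (w z * \<bar>dilate \<kappa> 1 u z\<bar> powr p) + ennreal (w z * \<bar>dilate \<kappa> (- 1) u z\<bar> powr p)"
      using w0 by (intro ennreal_plus) auto
    finally show "ennreal (w z * E z) + (ennreal (w z * \<bar>u z\<bar> powr p) + ennreal (w z * \<bar>u z\<bar> powr p)) =
      ennreal (w z * \<bar>dilate \<kappa> 1 u z\<bar> powr p) + ennreal (w z * \<bar>dilate \<kappa> (- 1) u z\<bar> powr p)" .
  qed
  also have "\<dots> = weighted_integral \<alpha> \<beta> p (dilate \<kappa> 1 u) + weighted_integral \<alpha> \<beta> p (dilate \<kappa> (- 1) u)"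
    by (simp add: nn_integral_add weighted_integral_weight w_def)
  also have "\<dots> = (weighted_integral \<alpha> \<beta> p u + weighted_integral \<alpha> \<beta> p u) + 0" by (simp add: dil)
  finally have "(\<integral>\<^sup>+z. ennreal (w z * E z) \<partial>lborel) = 0"
    using fin by (subst (asm) ennreal_add_left_cancel) auto
  then have "AE z in lborel. ennreal (w z * E z) = 0"
    by (subst (asm) nn_integral_0_iff_AE) auto
  then show "AE z in lborel. dilate \<kappa> (- 1) u z = u z" using E AE_fst_nonzero
  proof eventually_elim
    case (elim z)
    then have "w z > 0" using w0[of z] weight_eq_0_iff[of \<alpha> \<beta> z] unfolding w_def by linarith
    with elim have "E z = 0" by (auto simp: ennreal_eq_0_iff mult_le_0_iff)
    then show ?case using elim by simp
  qed
qed

section \<open>Best constants are not achieved\<close>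

theorem theorem1p4:
  fixes p a b \<gamma> :: real
  assumes "p > 1"
    and "real DIM('k::euclidean_space) + a > 0"
    and "real DIM('k \<times> 'm::euclidean_space) + a - p > b"
    and "real DIM('k) + a - p > b - \<gamma>"
    and "\<gamma> \<ge> b"
  shows "\<not> (\<exists>(u :: 'k \<times> 'm \<Rightarrow> real) G.
            (u, G) \<in> D1p p a b \<and> \<not> (AE z in lborel. u z = 0) \<and>
            weighted_integral a (- b) p G =
              best_constant TYPE('k \<times> 'm) p a b \<gamma> *
              weighted_integral (a - p - b + \<gamma>) (- \<gamma>) p u)"
proof
  assume "\<exists>(u :: 'k \<times> 'm \<Rightarrow> real) G.
            (u, G) \<in> D1p p a b \<and> \<not> (AE z in lborel. u z = 0) \<and>
            weighted_integral a (- b) p G =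
              best_constant TYPE('k \<times> 'm) p a b \<gamma> *
              weighted_integral (a - p - b + \<gamma>) (- \<gamma>) p u"
  then obtain u :: "'k \<times> 'm \<Rightarrow> real" and G where uG: "(u, G) \<in> D1p p a b"
    and nz: "\<not> (AE z in lborel. u z = 0)"
    and eq: "weighted_integral a (- b) p G = best_constant TYPE('k \<times> 'm) p a b \<gamma> *
        weighted_integral (a - p - b + \<gamma>) (- \<gamma>) p u" by blast
  have [measurable]: "u \<in> borel_measurable borel" using uG by (simp add: D1p_def)
  note finite = D1p_finite[OF assms(1,2,3) uG]
  \<comment> \<open>An infinite constant could only be attained with zero mass on the right, as the energy is finite.\<close>
  have "weighted_integral (a - p - b + \<gamma>) (- \<gamma>) p u \<noteq> 0"
    using nz by (simp add: weighted_integral_eq_0_iff)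
  then have S: "best_constant TYPE('k \<times> 'm) p a b \<gamma> < top"
    using finite(1) unfolding eq by (auto simp: ennreal_mult_less_top less_top)
  define H where "H = (real DIM('k \<times> 'm) + a - b - p) / p"
  have H: "H * p = real DIM('k \<times> 'm) + a - b - p" using assms(1) by (simp add: H_def)
  then have H': "H * p = real DIM('k \<times> 'm) + a + (- b - p)" by simp
  have "AE z in lborel. u z = 0"
    by (rule dilate_eq_exp_imp_zero[OF _ assms(1) H' finite(2)
          dilate_eq_exp_if_gradient_proportional[OF assms(1) H uG
            minimiser_gradient_proportional_dilate[OF assms(1,2) H assms(3) uG S eq]]]) simp
  with nz show False by contradiction
qed

end
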